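(* Let $S$ and $\hat S$ be the slice sampler and hybrid slice sampler kernels on $\mathsf X_1$ (defined in the context). Let $\gamma:(0,\|\tilde m\|_\infty)\to[0,1]$ be a measurable function such that $\|Q_{1,z}\|_{\Pi_{1,z}}\le\gamma(z)$ for $M_2$-a.e. $z\in(0,\|\tilde m\|_\infty)$. Let $t$ be a positive integer, and let $\alpha_t\in[0,1]$ be such that $$\frac1{\tilde m(y)}\int_0^{\tilde m(y)}\gamma(z)^t\,dz\le\alpha_t$$ for $M_1$-a.e. $y\in\mathsf X_1$. If either $t$ is even, or $Q_{1,z}$ is positive semi-definite for $M_2$-a.e. $z\in(0,\|\tilde m\|_\infty)$, then, for every $f\in L_0^2(M_1)\setminus\{0\}$, $$\frac{\langle f,\hat Sf\rangle_{M_1}^t}{\|f\|_{M_1}^{2t}}\le\frac{\langle f,Sf\rangle_{M_1}}{\|f\|_{M_1}^2}+\alpha_t.$$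
   Context: $L^2$ conventions. For a probability measure $\omega$, $L_0^2(\omega)$ is the real Hilbert space of square-integrable functions with $\omega$-mean zero (modulo a.e. equality), with inner product $\langle\cdot,\cdot\rangle_\omega$ and norm $\|\cdot\|_\omega$. A Markov kernel $K$ reversible with respect to $\omega$ acts as a self-adjoint operator on $L_0^2(\omega)$ by $Kf(y)=\int K(y,dy')f(y')$; $\|K\|_\omega\in[0,1]$ is its operator norm on $L_0^2(\omega)$, and $K$ is positive semi-definite if $\langle f,Kf\rangle_\omega\ge0$ for all $f\in L_0^2(\omega)$. Slice sampler setting. $\mathsf X_1$ is a non-empty open subset of $\mathbb R^d$, $d\ge1$. $M_1$ is a probability measure on $\mathsf X_1$ with possibly un-normalized Lebesgue density $\tilde m:\mathsf X_1\to(0,\infty)$ whose essential supremum $\|\tilde m\|_\infty$ is finite. $\mathsf X_2=(0,\|\tilde m\|_\infty)$. For $y\in\mathsf X_1$, $\Pi_{2,y}$ is the uniform distribution on $(0,\tilde m(y))$. The joint distribution $\Pi$ is the uniform distribution on $\{(y,z)\in\mathsf X_1\times\mathsf X_2:z<\tilde m(y)\}$; $M_2$ is its second marginal, with density proportional to the Lebesgue measure of $G_z=\{y\in\mathsf X_1:z<\tilde m(y)\}$. For $z\in\mathsf X_2$, $\Pi_{1,z}$ is the uniform distribution on $G_z$, and $Q_{1,z}$ is a Markov kernel on $\mathsf X_1$ reversible with respect to $\Pi_{1,z}$, with $(y,z)\mapsto Q_{1,z}(y,A)$ measurable for every Borel $A$. Define $$S(y,dy')=\int_{\mathsf X_2}\Pi_{2,y}(dz)\,\Pi_{1,z}(dy'),\qquad\hat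 S(y,dy')=\int_{\mathsf X_2}\Pi_{2,y}(dz)\,Q_{1,z}(y,dy').$$ Both are reversible with respect to $M_1$. *)

theory Defs
  imports "HOL-Probability.Probability"
begin

section \<open>Square-integrable functions with mean zero and Markov kernels\<close>

text \<open>
  Elements of \<open>L\<^sub>0\<^sup>2(\<omega>)\<close> are represented by functions; the zero class consists of the
  functions vanishing almost everywhere.
\<close>

definition L2_zero :: "'a measure \<Rightarrow> ('a \<Rightarrow> real) set" where
  "L2_zero \<omega> = {f. f \<in> borel_measurable \<omega> \<and> integrable \<omega> (\<lambda>y. (f y)\<^sup>2) \<and> (\<integral>y. f y \<partial>\<omega>) = 0}"

definition l2_inner :: "'a measure \<Rightarrow> ('a \<Rightarrow> real) \<Rightarrow> ('a \<Rightarrow> real) \<Rightarrow> real" where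
  "l2_inner \<omega> f g = (\<integral>y. f y * g y \<partial>\<omega>)"

definition l2_norm :: "'a measure \<Rightarrow> ('a \<Rightarrow> real) \<Rightarrow> real" where
  "l2_norm \<omega> f = sqrt (l2_inner \<omega> f f)"

definition markov_kernel :: "'a measure \<Rightarrow> ('a \<Rightarrow> 'a measure) \<Rightarrow> bool" where
  "markov_kernel M K \<longleftrightarrow> K \<in> M \<rightarrow>\<^sub>M prob_algebra M"

definition reversible :: "'a measure \<Rightarrow> ('a \<Rightarrow> 'a measure) \<Rightarrow> bool" where
  "reversible \<omega> K \<longleftrightarrow> (\<forall>A \<in> sets \<omega>. \<forall>B \<in> sets \<omega>.
     (\<integral>\<^sup>+y\<in>A. emeasure (K y) B \<partial>\<omega>) = (\<integral>\<^sup>+y\<in>B. emeasure (K y) A \<partial>\<omega>))"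

definition kernel_op :: "('a \<Rightarrow> 'a measure) \<Rightarrow> ('a \<Rightarrow> real) \<Rightarrow> 'a \<Rightarrow> real" where
  "kernel_op K f y = (\<integral>y'. f y' \<partial>(K y))"

text \<open>
  The supremum below is over a nonempty set, which is bounded by 1 when \<open>K\<close> is a Markov kernel
  reversible with respect to the probability measure \<open>\<omega>\<close>.
\<close>

definition kernel_norm :: "'a measure \<Rightarrow> ('a \<Rightarrow> 'a measure) \<Rightarrow> real" where
  "kernel_norm \<omega> K = (SUP f \<in> {f \<in> L2_zero \<omega>. l2_norm \<omega> f \<le> 1}. l2_norm \<omega> (kernel_op K f))"

definition kernel_psd :: "'a measure \<Rightarrow> ('a \<Rightarrow> 'a measure) \<Rightarrow> bool" where
  "kernel_psd \<omega> K \<longleftrightarrow> (\<forall>f \<in> L2_zero \<omega>. 0 \<le> l2_inner \<omega> f (kernel_op K f))"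


section \<open>Slice sampling\<close>

text \<open>
  Throughout, \<open>X\<close> is the state space and \<open>m\<close> the un-normalized density on it; only the values of
  \<open>m\<close> on \<open>X\<close> matter.
\<close>

definition ess_sup :: "'a::euclidean_space set \<Rightarrow> ('a \<Rightarrow> real) \<Rightarrow> ereal" where
  "ess_sup X m = esssup (restrict_space lborel X) (\<lambda>y. ereal (m y))"

definition X2 :: "'a::euclidean_space set \<Rightarrow> ('a \<Rightarrow> real) \<Rightarrow> real set" where
  "X2 X m = {0 <..< real_of_ereal (ess_sup X m)}"

definition M1 :: "'a::euclidean_space set \<Rightarrow> ('a \<Rightarrow> real) \<Rightarrow> 'a measure" where
  "M1 X m = density (restrict_space lborel X)
     (\<lambda>y. ennreal (m y / (\<integral>x. m x \<partial>(restrict_space lborel X))))"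

definition G :: "'a::euclidean_space set \<Rightarrow> ('a \<Rightarrow> real) \<Rightarrow> real \<Rightarrow> 'a set" where
  "G X m z = {y \<in> X. z < m y}"

definition Pi1 :: "'a::euclidean_space set \<Rightarrow> ('a \<Rightarrow> real) \<Rightarrow> real \<Rightarrow> 'a measure" where
  "Pi1 X m z = uniform_measure (restrict_space lborel X) (G X m z)"

definition Pi2 :: "('a::euclidean_space \<Rightarrow> real) \<Rightarrow> 'a \<Rightarrow> real measure" where
  "Pi2 m y = uniform_measure lborel {0 <..< m y}"

definition Pi_joint :: "'a::euclidean_space set \<Rightarrow> ('a \<Rightarrow> real) \<Rightarrow> ('a \<times> real) measure" where
  "Pi_joint X m = uniform_measure (restrict_space lborel X \<Otimes>\<^sub>M restrict_space lborel (X2 X m))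
     {(y, z) \<in> X \<times> X2 X m. z < m y}"

definition M2 :: "'a::euclidean_space set \<Rightarrow> ('a \<Rightarrow> real) \<Rightarrow> real measure" where
  "M2 X m = distr (Pi_joint X m) (restrict_space borel (X2 X m)) snd"

text \<open>
  The mixtures over \<open>z\<close> are taken over \<open>X2\<close> only: on the null set of points \<open>y\<close> where \<open>m y\<close>
  exceeds the essential supremum, \<open>Pi2 m y\<close> also charges levels \<open>z\<close> for which \<open>G X m z\<close> is null
  and \<open>Pi1 X m z\<close> is meaningless.
\<close>

definition slice_kernel :: "'a::euclidean_space set \<Rightarrow> ('a \<Rightarrow> real) \<Rightarrow> 'a \<Rightarrow> 'a measure" where
  "slice_kernel X m y = restrict_space (Pi2 m y) (X2 X m) \<bind> (\<lambda>z. Pi1 X m z)"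

definition hybrid_slice_kernel ::
    "'a::euclidean_space set \<Rightarrow> ('a \<Rightarrow> real) \<Rightarrow> (real \<Rightarrow> 'a \<Rightarrow> 'a measure) \<Rightarrow> 'a \<Rightarrow> 'a measure" where
  "hybrid_slice_kernel X m Q y = restrict_space (Pi2 m y) (X2 X m) \<bind> (\<lambda>z. Q z y)"

end

theory Submission
  imports Defs
begin

text \<open>
  For a level \<open>z\<close> let \<open>A z\<close>, \<open>B z\<close> and \<open>E z\<close> be the Lebesgue measure of \<open>G X m z\<close> times,
  respectively, the mean of \<open>f\<^sup>2\<close>, the squared mean of \<open>f\<close> and the quadratic form of \<open>Q z\<close> at \<open>f\<close>,
  all under \<open>Pi1 X m z\<close>. By Fubini and up to the common factor \<open>\<integral>m\<close>, their integrals are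
  \<open>\<parallel>f\<parallel>\<^sup>2\<close> and the quadratic forms of the slice sampler and of the hybrid one at \<open>f\<close>. Splitting
  \<open>f\<close> on each slice into its mean and its centred part gives \<open>\<bar>E - B\<bar> \<le> \<gamma> (A - B)\<close>. Hence the
  normalized hybrid form is bounded in absolute value by the average of a function with value 1 on
  mass \<open>B\<close> and value \<open>\<gamma>\<close> on mass \<open>A - B\<close>, and Jensen's inequality for \<open>x \<mapsto> x\<^sup>t\<close> bounds the
  \<open>t\<close>-th power by the average of \<open>B + \<gamma>\<^sup>t (A - B)\<close>. Finally \<open>\<integral>\<gamma>\<^sup>t A\<close> is evaluated by
  integrating over the levels first.
\<close>

section \<open>Integration against kernels\<close>

text \<open>Fubini for a kernel and an integrable \<open>f\<close> of either sign. The positive and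
  negative parts have finite double integrals, so their inner integrals are finite almost everywhere
  and can be subtracted as reals.\<close>

lemma
  fixes f :: "'b \<Rightarrow> real"
  assumes K: "K \<in> M \<rightarrow>\<^sub>M subprob_algebra B" and f: "f \<in> borel_measurable B"
    and int: "integrable (M \<bind> K) f"
  shows AE_integrable_bind: "AE x in M. integrable (K x) f"
    and integral_bind_integrable: "(\<integral>y. f y \<partial>(M \<bind> K)) = (\<integral>x. (\<integral>y. f y \<partial>K x) \<partial>M)"
proof -
  note [measurable] = K f
  let ?P = "\<lambda>x. \<integral>\<^sup>+y. ennreal (f y) \<partial>K x"
  let ?N = "\<lambda>x. \<integral>\<^sup>+y. ennreal (- f y) \<partial>K x"
  have "(\<integral>\<^sup>+x. \<integral>\<^sup>+y. ennreal \<bar>f y\<bar> \<partial>K x \<partial>M) = (\<integral>\<^sup>+y. ennreal \<bar>f y\<bar> \<partial>(M \<bind> K))"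
    by (rule nn_integral_bind[symmetric, OF _ K]) simp
  also have "\<dots> < \<infinity>"
    using int by (simp add: integrable_iff_bounded)
  finally have fin: "(\<integral>\<^sup>+x. \<integral>\<^sup>+y. ennreal \<bar>f y\<bar> \<partial>K x \<partial>M) < \<infinity>" .
  have meas: "f \<in> borel_measurable (K x)" if "x \<in> space M" for x
    using f sets_kernel[OF K that] by (simp cong: measurable_cong_sets)
  have "AE x in M. (\<integral>\<^sup>+y. ennreal \<bar>f y\<bar> \<partial>K x) \<noteq> \<infinity>"
    by (rule nn_integral_PInf_AE) (use fin in auto)
  then show ae: "AE x in M. integrable (K x) f"
    by (rule AE_mp, intro AE_I2) (auto simp: integrable_iff_bounded meas less_top)
  have [measurable]: "(\<lambda>x. \<integral>y. f y \<partial>K x) \<in> borel_measurable M"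
    by measurable
  have P: "(\<integral>\<^sup>+x. ?P x \<partial>M) = (\<integral>\<^sup>+y. ennreal (f y) \<partial>(M \<bind> K))"
    by (rule nn_integral_bind[symmetric, OF _ K]) simp
  have N: "(\<integral>\<^sup>+x. ?N x \<partial>M) = (\<integral>\<^sup>+y. ennreal (- f y) \<partial>(M \<bind> K))"
    by (rule nn_integral_bind[symmetric, OF _ K]) simp
  have finP: "(\<integral>\<^sup>+x. ?P x \<partial>M) < \<infinity>" and finN: "(\<integral>\<^sup>+x. ?N x \<partial>M) < \<infinity>"
    unfolding P N using int by (simp_all add: real_integrable_def less_top)
  have mP: "?P \<in> borel_measurable M" and mN: "?N \<in> borel_measurable M"
    by measurable
  have aP: "AE x in M. ?P x \<noteq> \<infinity>" and aN: "AE x in M. ?N x \<noteq> \<infinity>"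
    by (rule nn_integral_PInf_AE; use finP finN mP mN in auto)+
  have eP: "(\<integral>\<^sup>+x. ennreal (enn2real (?P x)) \<partial>M) = (\<integral>\<^sup>+x. ?P x \<partial>M)"
    by (rule nn_integral_cong_AE, use aP in eventually_elim) (auto simp: less_top)
  have eN: "(\<integral>\<^sup>+x. ennreal (enn2real (?N x)) \<partial>M) = (\<integral>\<^sup>+x. ?N x \<partial>M)"
    by (rule nn_integral_cong_AE, use aN in eventually_elim) (auto simp: less_top)
  have iP: "integrable M (\<lambda>x. enn2real (?P x))" and iN: "integrable M (\<lambda>x. enn2real (?N x))"
    by (rule integrableI_nonneg; use eP eN finP finN mP mN in auto)+
  \<comment> \<open>Where \<open>f\<close> is not integrable under \<open>K x\<close>, the inner
    Bochner integral has its default value 0; this happens on a null set only.\<close>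
  have "(\<integral>x. (\<integral>y. f y \<partial>K x) \<partial>M) = (\<integral>x. enn2real (?P x) - enn2real (?N x) \<partial>M)"
    by (rule integral_cong_AE) (use mP mN ae in \<open>auto simp: real_lebesgue_integral_def elim!: eventually_mono\<close>)
  also have "\<dots> = (\<integral>x. enn2real (?P x) \<partial>M) - (\<integral>x. enn2real (?N x) \<partial>M)"
    using iP iN by simp
  also have "\<dots> = enn2real (\<integral>\<^sup>+x. ?P x \<partial>M) - enn2real (\<integral>\<^sup>+x. ?N x \<partial>M)"
    using mP mN by (simp add: integral_eq_nn_integral eP eN)
  also have "\<dots> = (\<integral>y. f y \<partial>(M \<bind> K))"
    unfolding P N by (simp add: real_lebesgue_integral_def[OF int])
  finally show "(\<integral>y. f y \<partial>(M \<bind> K)) = (\<integral>x. (\<integral>y. f y \<partial>K x) \<partial>M)" ..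
qed

text \<open>Nonnegativity of the variance. With the right side in \<open>ennreal\<close> an infinite
  second moment is allowed, as may occur under a single measure \<open>K y\<close>.\<close>

lemma (in prob_space) square_integral_le:
  fixes f :: "'a \<Rightarrow> real"
  assumes [measurable]: "f \<in> borel_measurable M"
  shows "ennreal ((\<integral>x. f x \<partial>M)\<^sup>2) \<le> (\<integral>\<^sup>+x. ennreal ((f x)\<^sup>2) \<partial>M)"
proof (cases "integrable M (\<lambda>x. (f x)\<^sup>2)")
  case True
  have "integrable M f"
    using square_integrable_imp_integrable[OF assms True] .
  from variance_eq[OF this True] variance_positive[of f]
  have "(\<integral>x. f x \<partial>M)\<^sup>2 \<le> (\<integral>x. (f x)\<^sup>2 \<partial>M)" by simp
  then show ?thesis
    using nn_integral_eq_integral[OF True] by (simp add: ennreal_leI)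
next
  case False
  then have "(\<integral>\<^sup>+x. ennreal ((f x)\<^sup>2) \<partial>M) = \<infinity>"
    by (auto simp: integrable_iff_bounded less_top[symmetric])
  then show ?thesis by simp
qed

section \<open>Products of square-integrable functions and the Cauchy-Schwarz inequality\<close>

lemma abs_mult_le_sum_squares: "\<bar>a * b\<bar> \<le> a\<^sup>2 + b\<^sup>2" for a b :: real
  using sum_squares_bound[of "\<bar>a\<bar>" "\<bar>b\<bar>"] mult_nonneg_nonneg[OF abs_ge_zero[of a] abs_ge_zero[of b]]
  unfolding abs_mult power2_abs by linarith

lemma integrable_mult_squares:
  fixes f g :: "'a \<Rightarrow> real"
  assumes [measurable]: "f \<in> borel_measurable M" "g \<in> borel_measurable M"
    and f: "integrable M (\<lambda>x. (f x)\<^sup>2)" and g: "integrable M (\<lambda>x. (g x)\<^sup>2)"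
  shows "integrable M (\<lambda>x. f x * g x)"
proof (rule Bochner_Integration.integrable_bound)
  show "integrable M (\<lambda>x. (f x)\<^sup>2 + (g x)\<^sup>2)" using f g by simp
  show "AE x in M. norm (f x * g x) \<le> norm ((f x)\<^sup>2 + (g x)\<^sup>2)"
    using abs_mult_le_sum_squares by simp
qed simp

lemma Cauchy_Schwarz_integral:
  fixes f g :: "'a \<Rightarrow> real"
  assumes [measurable]: "f \<in> borel_measurable M" "g \<in> borel_measurable M"
    and f: "integrable M (\<lambda>x. (f x)\<^sup>2)" and g: "integrable M (\<lambda>x. (g x)\<^sup>2)"
  shows "\<bar>\<integral>x. f x * g x \<partial>M\<bar> \<le> sqrt (\<integral>x. (f x)\<^sup>2 \<partial>M) * sqrt (\<integral>x. (g x)\<^sup>2 \<partial>M)"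
proof -
  have fg: "integrable M (\<lambda>x. \<bar>f x\<bar> * \<bar>g x\<bar>)"
    using integrable_abs[OF integrable_mult_squares[OF assms]] by (simp add: abs_mult)
  have "(\<integral>\<^sup>+x. ennreal \<bar>f x\<bar> * ennreal \<bar>g x\<bar> \<partial>M)\<^sup>2
      \<le> (\<integral>\<^sup>+x. (ennreal \<bar>f x\<bar>)\<^sup>2 \<partial>M) * (\<integral>\<^sup>+x. (ennreal \<bar>g x\<bar>)\<^sup>2 \<partial>M)"
    by (rule Cauchy_Schwarz_nn_integral) auto
  then have "ennreal ((\<integral>x. \<bar>f x\<bar> * \<bar>g x\<bar> \<partial>M)\<^sup>2)
      \<le> ennreal ((\<integral>x. (f x)\<^sup>2 \<partial>M) * (\<integral>x. (g x)\<^sup>2 \<partial>M))"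
    using nn_integral_eq_integral[OF fg] nn_integral_eq_integral[OF f] nn_integral_eq_integral[OF g]
    by (simp add: ennreal_power ennreal_mult[symmetric])
  then have "(\<integral>x. \<bar>f x\<bar> * \<bar>g x\<bar> \<partial>M)\<^sup>2 \<le> (\<integral>x. (f x)\<^sup>2 \<partial>M) * (\<integral>x. (g x)\<^sup>2 \<partial>M)"
    by (subst (asm) ennreal_le_iff) auto
  then have "(\<integral>x. \<bar>f x\<bar> * \<bar>g x\<bar> \<partial>M) \<le> sqrt ((\<integral>x. (f x)\<^sup>2 \<partial>M) * (\<integral>x. (g x)\<^sup>2 \<partial>M))"
    by (rule real_le_rsqrt)
  moreover have "\<bar>\<integral>x. f x * g x \<partial>M\<bar> \<le> (\<integral>x. \<bar>f x\<bar> * \<bar>g x\<bar> \<partial>M)"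
    using integral_abs_bound[of M "\<lambda>x. f x * g x"] by (simp add: abs_mult)
  ultimately show ?thesis by (simp add: real_sqrt_mult)
qed

text \<open>Invariance is the consequence of reversibility on which the estimates rest: it turns
  \<open>P\<close>-averages of \<open>K y\<close>-averages into \<open>P\<close>-averages. The
  constant kernel with value \<open>P\<close> has it too, which covers the slice sampler.\<close>

locale stationary_kernel = prob_space P for P :: "'a measure" +
  fixes K :: "'a \<Rightarrow> 'a measure"
  assumes kernel: "markov_kernel P K" and stationary: "P \<bind> K = P"
begin

lemma measurable_kernel [measurable]: "K \<in> P \<rightarrow>\<^sub>M subprob_algebra P"
  using kernel by (auto simp: markov_kernel_def intro: measurable_prob_algebraD)

lemma prob_space_kernel: "y \<in> space P \<Longrightarrow> prob_space (K y)"
  using kernel measurable_space[of K P "prob_algebra P" y]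
  by (auto simp: markov_kernel_def space_prob_algebra)

lemma measurable_nn_integral_kernel:
  "g \<in> borel_measurable P \<Longrightarrow> (\<lambda>y. \<integral>\<^sup>+y'. g y' \<partial>K y) \<in> borel_measurable P"
  by (rule measurable_compose[OF measurable_kernel nn_integral_measurable_subprob_algebra])

lemma nn_integral_kernel:
  "g \<in> borel_measurable P \<Longrightarrow> (\<integral>\<^sup>+y. \<integral>\<^sup>+y'. g y' \<partial>K y \<partial>P) = (\<integral>\<^sup>+y. g y \<partial>P)"
  using nn_integral_bind[OF _ measurable_kernel, of g] by (simp add: stationary)

lemma measurable_kernel_op [measurable]:
  "f \<in> borel_measurable P \<Longrightarrow> kernel_op K f \<in> borel_measurable P"
  unfolding kernel_op_def[abs_def]
  by (rule measurable_compose[OF measurable_kernel integral_measurable_subprob_algebra])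

lemma kernel_op_square_le:
  assumes "f \<in> borel_measurable P" and "y \<in> space P"
  shows "ennreal ((kernel_op K f y)\<^sup>2) \<le> (\<integral>\<^sup>+y'. ennreal ((f y')\<^sup>2) \<partial>K y)"
proof -
  interpret Ky: prob_space "K y" by (rule prob_space_kernel) fact
  have "f \<in> borel_measurable (K y)"
    using assms sets_kernel[OF measurable_kernel, of y] by (simp cong: measurable_cong_sets)
  then show ?thesis
    unfolding kernel_op_def by (rule Ky.square_integral_le)
qed

text \<open>Contraction in the square norm: the squared mean is at most the mean of the square under
  each \<open>K y\<close>, and invariance evaluates the double integral.\<close>

lemma nn_integral_kernel_op_square_le:
  assumes [measurable]: "f \<in> borel_measurable P"
  shows "(\<integral>\<^sup>+y. ennreal ((kernel_op K f y)\<^sup>2) \<partial>P) \<le> (\<integral>\<^sup>+y. ennreal ((f y)\<^sup>2) \<partial>P)"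
proof -
  have "(\<integral>\<^sup>+y. ennreal ((kernel_op K f y)\<^sup>2) \<partial>P) \<le> (\<integral>\<^sup>+y. \<integral>\<^sup>+y'. ennreal ((f y')\<^sup>2) \<partial>K y \<partial>P)"
    by (intro nn_integral_mono kernel_op_square_le) auto
  also have "\<dots> = (\<integral>\<^sup>+y. ennreal ((f y)\<^sup>2) \<partial>P)"
    by (rule nn_integral_kernel) simp
  finally show ?thesis .
qed

context
  fixes f :: "'a \<Rightarrow> real"
  assumes f [measurable]: "f \<in> borel_measurable P" and f2: "integrable P (\<lambda>y. (f y)\<^sup>2)"
begin

lemma integrable_kernel_op_square: "integrable P (\<lambda>y. (kernel_op K f y)\<^sup>2)"
  using le_less_trans[OF nn_integral_kernel_op_square_le[OF f]] f2
  by (intro integrableI_nonneg) (auto simp: integrable_iff_bounded)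

lemma integral_kernel_op_square_le: "(\<integral>y. (kernel_op K f y)\<^sup>2 \<partial>P) \<le> (\<integral>y. (f y)\<^sup>2 \<partial>P)"
  using nn_integral_kernel_op_square_le[OF f]
  by (simp add: nn_integral_eq_integral[OF integrable_kernel_op_square]
      nn_integral_eq_integral[OF f2] ennreal_le_iff)

lemma integrable_of_square: "integrable P f"
  using square_integrable_imp_integrable[OF f f2] .

lemma AE_integrable_kernel: "AE y in P. integrable (K y) f"
  using AE_integrable_bind[OF measurable_kernel f] integrable_of_square by (simp add: stationary)

lemma integral_kernel_op: "(\<integral>y. kernel_op K f y \<partial>P) = (\<integral>y. f y \<partial>P)"
  using integral_bind_integrable[OF measurable_kernel f] integrable_of_square
  by (simp add: stationary kernel_op_def)

end

lemma kernel_op_L2_zero: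
  assumes "g \<in> L2_zero P"
  shows "l2_norm P (kernel_op K g) \<le> l2_norm P g"
  using assms integral_kernel_op_square_le[of g]
  by (auto simp: L2_zero_def l2_norm_def l2_inner_def power2_eq_square)

text \<open>The defining inequality of an operator norm, extended from the unit ball by homogeneity.
  When the norm of \<open>g\<close> is 0, rescaling is impossible and the contraction property
  settles the case.\<close>

lemma kernel_op_norm_le:
  assumes g: "g \<in> L2_zero P"
  shows "l2_norm P (kernel_op K g) \<le> kernel_norm P K * l2_norm P g"
proof (cases "l2_norm P g = 0")
  case True
  with kernel_op_L2_zero[OF g] show ?thesis by simp
next
  case False
  define n where "n = l2_norm P g"
  have "0 \<le> n" unfolding n_def l2_norm_def l2_inner_def by simp
  then have n: "0 < n" using False n_def by simp
  have scale: "l2_norm P (\<lambda>y. a y / n) = l2_norm P a / n" for a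
  proof -
    have "l2_inner P (\<lambda>y. a y / n) (\<lambda>y. a y / n) = l2_inner P a a / n\<^sup>2"
      by (simp add: l2_inner_def power2_eq_square)
    then show ?thesis using n by (simp add: l2_norm_def real_sqrt_divide)
  qed
  let ?h = "\<lambda>y. g y / n"
  have h: "?h \<in> L2_zero P" "l2_norm P ?h \<le> 1"
    using g n unfolding scale by (auto simp: L2_zero_def power_divide n_def)
  have "l2_norm P (kernel_op K ?h) \<le> kernel_norm P K"
    unfolding kernel_norm_def
  proof (rule cSUP_upper)
    show "?h \<in> {f \<in> L2_zero P. l2_norm P f \<le> 1}" using h by simp
    \<comment> \<open>Contraction bounds the set by 1, so the supremum of reals is a genuine least
      upper bound.\<close>
    show "bdd_above ((\<lambda>f. l2_norm P (kernel_op K f)) ` {f \<in> L2_zero P. l2_norm P f \<le> 1})"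
      by (rule bdd_aboveI[of _ 1]) (use kernel_op_L2_zero in force)
  qed
  moreover have "kernel_op K ?h = (\<lambda>y. kernel_op K g y / n)"
    by (simp add: kernel_op_def fun_eq_iff)
  ultimately show ?thesis
    using n unfolding scale by (simp add: n_def[symmetric] field_simps scale)
qed

text \<open>Split \<open>f\<close> into its mean and the centred part \<open>g\<close>. The kernel
  fixes constants and preserves means, so the cross terms vanish and only the pairing of
  \<open>g\<close> with its image remains; Cauchy-Schwarz and the operator norm bound it by
  \<open>kernel_norm P K\<close> times the variance.\<close>

lemma l2_inner_kernel_op_bound:
  assumes f [measurable]: "f \<in> borel_measurable P" and f2: "integrable P (\<lambda>y. (f y)\<^sup>2)"
  defines "\<mu> \<equiv> \<integral>y. f y \<partial>P"
  shows "\<bar>l2_inner P f (kernel_op K f) - \<mu>\<^sup>2\<bar> \<le> kernel_norm P K * ((\<integral>y. (f y)\<^sup>2 \<partial>P) - \<mu>\<^sup>2)"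
proof -
  define g where "g = (\<lambda>y. f y - \<mu>)"
  have fi: "integrable P f" using integrable_of_square[OF f f2] .
  have [measurable]: "g \<in> borel_measurable P" unfolding g_def by measurable
  have g2: "integrable P (\<lambda>y. (g y)\<^sup>2)"
    unfolding g_def power2_diff using fi f2 by simp
  have gi: "integrable P g" using fi by (simp add: g_def)
  have g0: "(\<integral>y. g y \<partial>P) = 0" using fi by (simp add: g_def \<mu>_def prob_space)
  have gL: "g \<in> L2_zero P" using g2 g0 by (simp add: L2_zero_def)
  have var: "(\<integral>y. (g y)\<^sup>2 \<partial>P) = (\<integral>y. (f y)\<^sup>2 \<partial>P) - \<mu>\<^sup>2"
    unfolding g_def \<mu>_def by (rule variance_eq[OF fi f2])
  let ?Kg = "kernel_op K g"
  have Kg2: "integrable P (\<lambda>y. (?Kg y)\<^sup>2)" using integrable_kernel_op_square g2 by simp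
  have Kg0: "(\<integral>y. ?Kg y \<partial>P) = 0" using integral_kernel_op[OF _ g2] g0 by simp
  have Kgi: "integrable P ?Kg" by (rule square_integrable_imp_integrable[OF _ Kg2]) simp
  have gKg: "integrable P (\<lambda>y. g y * ?Kg y)" by (rule integrable_mult_squares) (use g2 Kg2 in auto)
  \<comment> \<open>Linearity of the inner integral uses that \<open>f\<close> is integrable under
    \<open>K y\<close>, which is known for almost every \<open>y\<close>.\<close>
  have "AE y in P. kernel_op K f y = ?Kg y + \<mu>"
    using AE_integrable_kernel[OF f f2] AE_space
  proof eventually_elim
    case (elim y)
    interpret Ky: prob_space "K y" by (rule prob_space_kernel) fact
    show ?case using elim by (simp add: kernel_op_def g_def Ky.prob_space)
  qed
  then have "l2_inner P f (kernel_op K f) = (\<integral>y. (g y + \<mu>) * (?Kg y + \<mu>) \<partial>P)"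
    unfolding l2_inner_def by (intro integral_cong_AE) (auto simp: g_def)
  also have "\<dots> = (\<integral>y. g y * ?Kg y + \<mu> * ?Kg y + \<mu> * g y + \<mu>\<^sup>2 \<partial>P)"
    by (simp add: algebra_simps power2_eq_square)
  also have "\<dots> = (\<integral>y. g y * ?Kg y \<partial>P) + \<mu>\<^sup>2"
    using gKg Kgi gi by (simp add: Kg0 g0 prob_space)
  finally have "\<bar>l2_inner P f (kernel_op K f) - \<mu>\<^sup>2\<bar> = \<bar>\<integral>y. g y * ?Kg y \<partial>P\<bar>"
    by simp
  also have "\<dots> \<le> sqrt (\<integral>y. (g y)\<^sup>2 \<partial>P) * sqrt (\<integral>y. (?Kg y)\<^sup>2 \<partial>P)"
    by (rule Cauchy_Schwarz_integral) (use g2 Kg2 in auto)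
  also have "\<dots> = l2_norm P g * l2_norm P ?Kg"
    by (simp add: l2_norm_def l2_inner_def power2_eq_square)
  also have "\<dots> \<le> l2_norm P g * (kernel_norm P K * l2_norm P g)"
    by (intro mult_left_mono kernel_op_norm_le gL) (simp add: l2_norm_def l2_inner_def)
  also have "\<dots> = kernel_norm P K * (\<integral>y. (g y)\<^sup>2 \<partial>P)"
    by (simp add: l2_norm_def l2_inner_def power2_eq_square[symmetric])
  finally show ?thesis unfolding var .
qed

end

text \<open>In the balance equation one of the two sets is taken to be the whole space, which has
  mass 1 under every \<open>K y\<close>.\<close>

lemma reversible_imp_stationary:
  assumes "prob_space P" "markov_kernel P K" "reversible P K"
  shows "stationary_kernel P K"
proof -
  interpret prob_space P by fact
  have K [measurable]: "K \<in> P \<rightarrow>\<^sub>M subprob_algebra P"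
    using assms(2) by (auto simp: markov_kernel_def intro: measurable_prob_algebraD)
  have pk: "prob_space (K y)" if "y \<in> space P" for y
    using assms(2) measurable_space[of K P "prob_algebra P" y] that
    by (auto simp: markov_kernel_def space_prob_algebra)
  have "P \<bind> K = P"
  proof (rule measure_eqI)
    show sets: "sets (P \<bind> K) = sets P"
      by (rule sets_bind_measurable[OF K not_empty])
    fix A assume "A \<in> sets (P \<bind> K)"
    then have A: "A \<in> sets P" using sets by simp
    have "emeasure (P \<bind> K) A = (\<integral>\<^sup>+y\<in>space P. emeasure (K y) A \<partial>P)"
      using emeasure_bind[OF not_empty K A] by (simp cong: nn_integral_cong)
    also have "\<dots> = (\<integral>\<^sup>+y\<in>A. emeasure (K y) (space P) \<partial>P)"
      using assms(3) A by (simp add: reversible_def)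
    also have "\<dots> = (\<integral>\<^sup>+y\<in>A. 1 \<partial>P)"
    proof (rule nn_integral_cong)
      fix y assume y: "y \<in> space P"
      have "space (K y) = space P"
        using sets_eq_imp_space_eq[OF sets_kernel[OF K y]] .
      then show "emeasure (K y) (space P) * indicator A y = 1 * indicator A y"
        using prob_space.emeasure_space_1[OF pk[OF y]] by simp
    qed
    also have "\<dots> = emeasure P A" using A by simp
    finally show "emeasure (P \<bind> K) A = emeasure P A" .
  qed
  then show ?thesis using assms by (simp add: stationary_kernel_def stationary_kernel_axioms_def)
qed

section \<open>The geometry of the slices\<close>

lemma integrable_divide_iff:
  fixes g :: "'a \<Rightarrow> real"
  assumes "k \<noteq> 0"
  shows "integrable M (\<lambda>x. g x / k) \<longleftrightarrow> integrable M g"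
  using assms by (simp add: divide_inverse)

locale slice_sampler =
  fixes X :: "'a::euclidean_space set" and m :: "'a \<Rightarrow> real"
  assumes open_X: "open X" and X_nonempty: "X \<noteq> {}"
    and integrable_m: "integrable (restrict_space lborel X) m"
    and m_pos: "\<And>y. y \<in> X \<Longrightarrow> 0 < m y"
    and ess_sup_finite: "ess_sup X m < \<infinity>"
begin

abbreviation "L \<equiv> restrict_space lborel X"
abbreviation "R \<equiv> restrict_space lborel (X2 X m)"

text \<open>The right end of the interval of levels; \<open>c\<close> below is the normalizing
  constant of \<open>m\<close>.\<close>

definition h :: real where "h = real_of_ereal (ess_sup X m)"
definition c :: real where "c = (\<integral>x. m x \<partial>L)"

text \<open>On \<open>X\<close> and the levels together this is the indicator of the region below
  the graph of \<open>m\<close>. As a real weight it replaces slice-dependent domains of integration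
  by the fixed measures \<open>L\<close> and \<open>R\<close>.\<close>

definition level :: "real \<Rightarrow> 'a \<Rightarrow> real" where
  "level z y = indicator (G X m z) y"

lemma X_sets [measurable]: "X \<in> sets borel"
  using open_X by simp

lemma X2_sets [measurable]: "X2 X m \<in> sets borel"
  by (simp add: X2_def)

lemma space_L [simp]: "space L = X" and space_R [simp]: "space R = X2 X m"
  by (simp_all add: space_restrict_space)

lemma sets_L: "sets L = sets (restrict_space borel X)"
  and sets_R: "sets R = sets (restrict_space borel (X2 X m))"
  by (simp_all add: sets_restrict_space)

sublocale L: sigma_finite_measure L
  by (rule sigma_finite_measure_restrict_space[OF sigma_finite_lborel]) simp

sublocale R: sigma_finite_measure R
  by (rule sigma_finite_measure_restrict_space[OF sigma_finite_lborel]) simp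

sublocale LR: pair_sigma_finite L R ..

lemma measurable_m [measurable]: "m \<in> borel_measurable L"
  using integrable_m by simp

lemma measurable_ident_R [measurable]: "(\<lambda>z. z) \<in> borel_measurable R"
  by (rule measurable_restrict_space1) simp

text \<open>Lebesgue measure on \<open>X\<close> is nonzero, since \<open>X\<close> contains a
  nonempty open box. This form refutes contradictory facts that hold almost everywhere.\<close>

lemma AE_L_False: "\<not> (AE y in L. False)"
proof
  assume "AE y in L. False"
  then have "AE y in lborel. y \<notin> X"
    by (subst (asm) AE_restrict_space_iff) auto
  then have "emeasure lborel X = 0"
    by (subst (asm) AE_iff_measurable[of X]) auto
  moreover have "emeasure lborel X \<noteq> 0"
  proof -
    obtain a b where ab: "box a b \<subseteq> X" "box a b \<noteq> {}"
      using X_nonempty open_X by (metis ex_in_conv open_contains_box empty_iff)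
    then have "0 < emeasure lborel (box a b)"
      by (auto simp: emeasure_lborel_box_eq box_ne_empty inner_diff_left intro!: prod_pos less_imp_le)
    also have "\<dots> \<le> emeasure lborel X"
      using ab by (intro emeasure_mono) auto
    finally show ?thesis by simp
  qed
  ultimately show False by simp
qed

lemma measurable_ereal_m [measurable]: "(\<lambda>y. ereal (m y)) \<in> borel_measurable L"
  by measurable

lemma AE_m_le_ess_sup: "AE y in L. ereal (m y) \<le> ess_sup X m"
  unfolding ess_sup_def by (rule esssup_AE)

lemma ess_sup_pos: "0 < ess_sup X m"
proof (rule ccontr)
  assume "\<not> 0 < ess_sup X m"
  then have le: "ess_sup X m \<le> ereal 0" by (simp add: zero_ereal_def)
  have "AE y in L. False"
    using AE_m_le_ess_sup AE_space
  proof eventually_elim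
    case (elim y)
    with le have "ereal (m y) \<le> ereal 0" by (blast intro: order_trans)
    with elim m_pos[of y] show ?case by simp
  qed
  with AE_L_False show False by simp
qed

lemma ess_sup_eq: "ess_sup X m = ereal h"
  using ess_sup_pos ess_sup_finite unfolding h_def by (cases "ess_sup X m") auto

lemma h_pos: "0 < h"
  using ess_sup_pos by (simp add: ess_sup_eq zero_ereal_def)

lemma X2_eq: "X2 X m = {0<..<h}"
  by (simp add: X2_def h_def)

lemma X2_nonempty: "X2 X m \<noteq> {}"
  using h_pos by (simp add: X2_eq)

lemma AE_m_le: "AE y in L. m y \<le> h"
  using AE_m_le_ess_sup by (simp add: ess_sup_eq)

lemma c_pos: "0 < c"
proof -
  have nonneg: "AE y in L. 0 \<le> m y"
    by (rule AE_I2) (use m_pos in \<open>auto intro: less_imp_le\<close>)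
  have "c \<noteq> 0"
  proof
    assume "c = 0"
    then have "AE y in L. m y = 0"
      using integral_nonneg_eq_0_iff_AE[OF integrable_m nonneg] by (simp add: c_def)
    then have "AE y in L. False"
      using AE_space by eventually_elim (use m_pos in force)
    with AE_L_False show False by simp
  qed
  moreover have "0 \<le> c"
    unfolding c_def by (rule integral_nonneg_AE[OF nonneg])
  ultimately show ?thesis by simp
qed

lemma G_sets [measurable]: "G X m z \<in> sets L"
proof -
  have "{y \<in> space L. z < m y} \<in> sets L" by measurable
  then show ?thesis by (simp add: G_def)
qed

lemma level_eq: "y \<in> X \<Longrightarrow> level z y = (if z < m y then 1 else 0)"
  by (simp add: level_def G_def)

lemma level_nonneg [simp]: "0 \<le> level z y" and level_le_1 [simp]: "level z y \<le> 1"
  by (simp_all add: level_def)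

lemma measurable_level [measurable]: "(\<lambda>(y, z). level z y) \<in> borel_measurable (L \<Otimes>\<^sub>M R)"
proof (subst measurable_cong)
  show "(\<lambda>(y, z). level z y) w = (if snd w < m (fst w) then 1 else 0)" if "w \<in> space (L \<Otimes>\<^sub>M R)" for w
    using that by (auto simp: space_pair_measure level_eq)
qed measurable

lemma emeasure_G_pos: "z \<in> X2 X m \<Longrightarrow> 0 < emeasure L (G X m z)"
  using esssup_pos_measure[OF measurable_ereal_m, of "ereal z"]
  by (simp add: X2_eq ess_sup_eq[unfolded ess_sup_def] G_def)

text \<open>Markov's inequality: on the slice \<open>m y / z\<close> exceeds 1, and \<open>m\<close>
  is integrable.\<close>

lemma emeasure_G_finite:
  assumes "z \<in> X2 X m"
  shows "emeasure L (G X m z) < \<infinity>"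
proof -
  have z: "0 < z" using assms by (simp add: X2_eq)
  have "integrable L (\<lambda>y. m y / z)" using integrable_m by simp
  then have "(\<integral>\<^sup>+y. ennreal (norm (m y / z)) \<partial>L) < \<infinity>" by (simp only: integrable_iff_bounded)
  moreover have "emeasure L (G X m z) = (\<integral>\<^sup>+y. indicator (G X m z) y \<partial>L)"
    by simp
  moreover have "\<dots> \<le> (\<integral>\<^sup>+y. ennreal (norm (m y / z)) \<partial>L)"
    by (rule nn_integral_mono) (use z in \<open>auto simp: indicator_def G_def simp flip: ennreal_1 intro!: ennreal_leI\<close>)
  ultimately show ?thesis by simp
qed

lemma measure_G_pos: "z \<in> X2 X m \<Longrightarrow> 0 < measure L (G X m z)"
  using emeasure_G_pos[of z] emeasure_G_finite[of z]
  by (simp add: measure_def enn2real_positive_iff)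

lemma emeasure_G_eq: "z \<in> X2 X m \<Longrightarrow> emeasure L (G X m z) = ennreal (measure L (G X m z))"
  using emeasure_G_finite[of z] by (simp add: emeasure_eq_ennreal_measure)

section \<open>The uniform distribution on a slice\<close>

lemma sets_Pi1 [simp, measurable_cong]: "sets (Pi1 X m z) = sets L"
  and space_Pi1 [simp]: "space (Pi1 X m z) = X"
  by (simp_all add: Pi1_def)

lemma prob_space_Pi1: "z \<in> X2 X m \<Longrightarrow> prob_space (Pi1 X m z)"
  unfolding Pi1_def using emeasure_G_pos[of z] emeasure_G_finite[of z]
  by (intro prob_space_uniform_measure) auto

text \<open>Describes all slices over the one measure \<open>L\<close>, as interchanging the
  integrals over \<open>y\<close> and \<open>z\<close> requires. The volume divided by is positive
  and finite.\<close>

lemma Pi1_eq_density: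
  assumes "z \<in> X2 X m"
  shows "Pi1 X m z = density L (\<lambda>y. ennreal (level z y / measure L (G X m z)))"
  unfolding Pi1_def uniform_measure_def emeasure_G_eq[OF assms] level_def
  using measure_G_pos[OF assms]
  by (auto intro!: arg_cong[where f="density L"] simp: fun_eq_iff indicator_def divide_ennreal[symmetric])

lemma measurable_level_fst [measurable]: "level z \<in> borel_measurable L"
  unfolding level_def by measurable

text \<open>Multiplying by the slice volume clears the denominator; this volume is, up to a
  constant, the density of \<open>M2\<close>.\<close>

lemma nn_integral_Pi1:
  assumes "z \<in> X2 X m" "g \<in> borel_measurable L"
  shows "(\<integral>\<^sup>+y. ennreal (level z y) * g y \<partial>L) = ennreal (measure L (G X m z)) * (\<integral>\<^sup>+y. g y \<partial>Pi1 X m z)"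
proof -
  note [measurable] = assms(2)
  let ?\<mu> = "measure L (G X m z)"
  have "ennreal ?\<mu> * (\<integral>\<^sup>+y. g y \<partial>Pi1 X m z) = (\<integral>\<^sup>+y. ennreal ?\<mu> * (ennreal (level z y / ?\<mu>) * g y) \<partial>L)"
    unfolding Pi1_eq_density[OF assms(1)] by (subst nn_integral_density) (auto simp: nn_integral_cmult)
  also have "\<dots> = (\<integral>\<^sup>+y. ennreal (level z y) * g y \<partial>L)"
    using measure_G_pos[OF assms(1)] by (simp add: mult.assoc[symmetric] ennreal_mult[symmetric])
  finally show ?thesis ..
qed

lemma integral_Pi1:
  fixes g :: "'a \<Rightarrow> real"
  assumes "z \<in> X2 X m" "g \<in> borel_measurable L"
  shows "(\<integral>y. level z y * g y \<partial>L) = measure L (G X m z) * (\<integral>y. g y \<partial>Pi1 X m z)"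
  unfolding Pi1_eq_density[OF assms(1)]
  using measure_G_pos[OF assms(1)] assms(2) by (subst integral_density) auto

lemma integrable_Pi1:
  fixes g :: "'a \<Rightarrow> real"
  assumes "z \<in> X2 X m" "g \<in> borel_measurable L"
  shows "integrable (Pi1 X m z) g \<longleftrightarrow> integrable L (\<lambda>y. level z y * g y)"
  unfolding Pi1_eq_density[OF assms(1)]
  using measure_G_pos[OF assms(1)] assms(2)
  by (subst integrable_density) (auto simp: integrable_divide_iff)

section \<open>The target measure and the law of the level given the point\<close>

lemma sets_M1 [simp, measurable_cong]: "sets (M1 X m) = sets L"
  and space_M1 [simp]: "space (M1 X m) = X"
  by (simp_all add: M1_def)

lemma M1_eq: "M1 X m = density L (\<lambda>y. ennreal (m y / c))"
  by (simp add: M1_def c_def)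

text \<open>The density \<open>m y / c\<close> is positive on all of \<open>X\<close>, so the null
  sets agree.\<close>

lemma AE_M1_iff: "(AE y in M1 X m. P y) \<longleftrightarrow> (AE y in L. P y)"
proof -
  have "(AE y in M1 X m. P y) \<longleftrightarrow> (AE y in L. 0 < ennreal (m y / c) \<longrightarrow> P y)"
    unfolding M1_eq by (rule AE_density) simp
  also have "\<dots> \<longleftrightarrow> (AE y in L. P y)"
    by (rule AE_cong) (use m_pos c_pos in auto)
  finally show ?thesis .
qed

lemma AE_m_c_nonneg: "AE y in L. 0 \<le> m y / c"
  by (rule AE_I2) (use m_pos c_pos in \<open>auto intro: less_imp_le\<close>)

lemma integral_M1:
  fixes g :: "'a \<Rightarrow> real"
  assumes "g \<in> borel_measurable L"
  shows "(\<integral>y. g y \<partial>M1 X m) = (\<integral>y. m y * g y \<partial>L) / c"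
  unfolding M1_eq by (subst integral_density) (use assms AE_m_c_nonneg in auto)

lemma integrable_M1:
  fixes g :: "'a \<Rightarrow> real"
  assumes "g \<in> borel_measurable L"
  shows "integrable (M1 X m) g \<longleftrightarrow> integrable L (\<lambda>y. m y * g y)"
  unfolding M1_eq by (subst integrable_density)
    (use assms AE_m_c_nonneg c_pos in \<open>auto simp: integrable_divide_iff\<close>)

text \<open>The total mass is \<open>min (m y) h / m y\<close>, which is below 1 when
  \<open>m y\<close> exceeds \<open>h\<close>. Hence mixtures over the levels are treated as
  subprobability measures.\<close>

lemma restrict_Pi2:
  assumes y: "y \<in> X"
  shows "restrict_space (Pi2 m y) (X2 X m) = density R (\<lambda>z. ennreal (level z y / m y))"
proof (rule measure_eqI)
  show "sets (restrict_space (Pi2 m y) (X2 X m)) = sets (density R (\<lambda>z. ennreal (level z y / m y)))"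
    by (simp add: sets_restrict_space Pi2_def)
  have [measurable]: "(\<lambda>z. level z y) \<in> borel_measurable R"
    using measurable_compose_Pair1[OF _ measurable_level, of y] y by simp
  fix A assume "A \<in> sets (restrict_space (Pi2 m y) (X2 X m))"
  then have A: "A \<subseteq> X2 X m" "A \<in> sets borel"
    by (auto simp: sets_restrict_space Pi2_def)
  then have AR: "A \<in> sets R" by (auto simp: sets_restrict_space)
  have my: "0 < m y" by (rule m_pos[OF y])
  have "emeasure (restrict_space (Pi2 m y) (X2 X m)) A = emeasure (Pi2 m y) A"
    using A by (subst emeasure_restrict_space) (auto simp: Pi2_def)
  also have "\<dots> = emeasure lborel ({0<..<m y} \<inter> A) / ennreal (m y)"
    unfolding Pi2_def using A my by (subst emeasure_uniform_measure) auto
  also have "\<dots> = (\<integral>\<^sup>+z. indicator ({0<..<m y} \<inter> A) z / ennreal (m y) \<partial>lborel)"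
    using A by (subst nn_integral_divide) auto
  also have "\<dots> = (\<integral>\<^sup>+z. ennreal (level z y / m y) * indicator A z * indicator (X2 X m) z \<partial>lborel)"
    using A my y by (intro nn_integral_cong)
      (auto simp: level_eq X2_eq indicator_def divide_ennreal[symmetric])
  also have "\<dots> = (\<integral>\<^sup>+z. ennreal (level z y / m y) * indicator A z \<partial>R)"
    by (subst nn_integral_restrict_space) auto
  also have "\<dots> = emeasure (density R (\<lambda>z. ennreal (level z y / m y))) A"
    using AR by (subst emeasure_density) auto
  finally show "emeasure (restrict_space (Pi2 m y) (X2 X m)) A
      = emeasure (density R (\<lambda>z. ennreal (level z y / m y))) A" .
qed

lemma measurable_level_snd: "y \<in> X \<Longrightarrow> (\<lambda>z. level z y) \<in> borel_measurable R"
  using measurable_compose_Pair1[OF _ measurable_level, of y] by simp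

text \<open>The integral is the smaller of \<open>m y\<close> and \<open>h\<close>, because the
  levels end at \<open>h\<close>.\<close>

lemma nn_integral_level_le:
  assumes "y \<in> X"
  shows "(\<integral>\<^sup>+z. ennreal (level z y) \<partial>R) \<le> ennreal (m y)"
proof -
  have "(\<integral>\<^sup>+z. ennreal (level z y) \<partial>R) = (\<integral>\<^sup>+z. ennreal (level z y) * indicator (X2 X m) z \<partial>lborel)"
    by (subst nn_integral_restrict_space) auto
  also have "\<dots> \<le> (\<integral>\<^sup>+z. indicator {0<..<m y} z \<partial>lborel)"
    by (rule nn_integral_mono) (auto simp: level_eq[OF assms] X2_eq indicator_def)
  also have "\<dots> = ennreal (m y)" using m_pos[OF assms] by simp
  finally show ?thesis .
qed

text \<open>By Tonelli the level can be integrated first, which leaves a weight of at most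
  \<open>m y\<close> on the square of \<open>f y\<close>.\<close>

lemma nn_integral_level_square_finite:
  assumes [measurable]: "f \<in> borel_measurable L" and f2: "integrable L (\<lambda>y. m y * (f y)\<^sup>2)"
  shows "(\<integral>\<^sup>+z. \<integral>\<^sup>+y. ennreal (level z y) * ennreal ((f y)\<^sup>2) \<partial>L \<partial>R) < \<infinity>"
proof -
  have "(\<integral>\<^sup>+z. \<integral>\<^sup>+y. ennreal (level z y) * ennreal ((f y)\<^sup>2) \<partial>L \<partial>R)
      = (\<integral>\<^sup>+y. \<integral>\<^sup>+z. ennreal (level z y) * ennreal ((f y)\<^sup>2) \<partial>R \<partial>L)"
    by (rule LR.Fubini') measurable
  also have "\<dots> = (\<integral>\<^sup>+y. (\<integral>\<^sup>+z. ennreal (level z y) \<partial>R) * ennreal ((f y)\<^sup>2) \<partial>L)"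
    by (intro nn_integral_cong nn_integral_multc) (simp add: measurable_level_snd)
  also have "\<dots> \<le> (\<integral>\<^sup>+y. ennreal (m y) * ennreal ((f y)\<^sup>2) \<partial>L)"
    by (intro nn_integral_mono mult_right_mono nn_integral_level_le) auto
  also have "\<dots> = (\<integral>\<^sup>+y. ennreal (norm (m y * (f y)\<^sup>2)) \<partial>L)"
    by (rule nn_integral_cong)
      (use m_pos in \<open>simp add: abs_mult less_imp_le ennreal_mult[symmetric]\<close>)
  also have "\<dots> < \<infinity>" using f2 by (simp only: integrable_iff_bounded)
  finally show ?thesis .
qed

end

section \<open>Mixtures of kernels over the levels\<close>

text \<open>\<open>W z y\<close> is \<open>Pi1 X m z\<close> for the slice sampler and
  \<open>Q z y\<close> for the hybrid one, so the formula for the quadratic form is derived once for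
  both.\<close>

locale slice_mixture = slice_sampler X m
  for X :: "'a::euclidean_space set" and m :: "'a \<Rightarrow> real" +
  fixes W :: "real \<Rightarrow> 'a \<Rightarrow> 'a measure"
  assumes measurable_W: "(\<lambda>(y, z). W z y) \<in> L \<Otimes>\<^sub>M R \<rightarrow>\<^sub>M subprob_algebra L"
    and stationary_W: "\<And>z. z \<in> X2 X m \<Longrightarrow> stationary_kernel (Pi1 X m z) (W z)"
begin

declare measurable_W [measurable]

definition mixture :: "'a \<Rightarrow> 'a measure" where
  "mixture y = restrict_space (Pi2 m y) (X2 X m) \<bind> (\<lambda>z. W z y)"

lemma measurable_W_fst: "y \<in> X \<Longrightarrow> (\<lambda>z. W z y) \<in> R \<rightarrow>\<^sub>M subprob_algebra L"
  using measurable_compose_Pair1[OF _ measurable_W, of y] by simp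

lemma nn_integral_mixture:
  assumes "y \<in> X" and "g \<in> borel_measurable L"
  shows "(\<integral>\<^sup>+y'. g y' \<partial>mixture y) = (\<integral>\<^sup>+z. ennreal (level z y / m y) * (\<integral>\<^sup>+y'. g y' \<partial>W z y) \<partial>R)"
proof -
  note [measurable] = assms(2) measurable_W_fst[OF assms(1)] measurable_level_snd[OF assms(1)]
  have "(\<integral>\<^sup>+y'. g y' \<partial>mixture y)
      = (\<integral>\<^sup>+z. \<integral>\<^sup>+y'. g y' \<partial>W z y \<partial>density R (\<lambda>z. ennreal (level z y / m y)))"
    unfolding mixture_def restrict_Pi2[OF assms(1)]
    by (rule nn_integral_bind[OF assms(2)]) simp
  then show ?thesis by (simp add: nn_integral_density)
qed

lemma sets_mixture: "y \<in> X \<Longrightarrow> sets (mixture y) = sets L"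
  unfolding mixture_def restrict_Pi2
  by (intro sets_bind_measurable) (auto simp: measurable_W_fst X2_nonempty)

lemma subprob_space_mixture:
  assumes y: "y \<in> X"
  shows "subprob_space (mixture y)"
  unfolding mixture_def
proof (rule subprob_space_bind)
  have "prob_space (Pi2 m y)"
    unfolding Pi2_def using m_pos[OF y] by (intro prob_space_uniform_measure) auto
  then have "emeasure (Pi2 m y) (X2 X m) \<le> 1"
    by (rule prob_space.emeasure_le_1)
  then show "subprob_space (restrict_space (Pi2 m y) (X2 X m))"
    using h_pos
    by (intro subprob_spaceI)
      (auto simp: emeasure_restrict_space space_restrict_space Pi2_def X2_eq)
  show "(\<lambda>z. W z y) \<in> restrict_space (Pi2 m y) (X2 X m) \<rightarrow>\<^sub>M subprob_algebra L"
    unfolding restrict_Pi2[OF y] using measurable_W_fst[OF y] by simp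
qed

lemma measurable_mixture [measurable]: "mixture \<in> L \<rightarrow>\<^sub>M subprob_algebra L"
proof (rule measurable_subprob_algebra)
  fix A assume [measurable]: "A \<in> sets L"
  have "emeasure (mixture y) A
      = (\<integral>\<^sup>+z. ennreal (level z y / m y) * emeasure (W z y) A \<partial>R)" if y: "y \<in> space L" for y
  proof -
    have "emeasure (mixture y) A = (\<integral>\<^sup>+y'. indicator A y' \<partial>mixture y)"
      using y sets_mixture by simp
    also have "\<dots> = (\<integral>\<^sup>+z. ennreal (level z y / m y) * (\<integral>\<^sup>+y'. indicator A y' \<partial>W z y) \<partial>R)"
      using y by (intro nn_integral_mixture) auto
    also have "\<dots> = (\<integral>\<^sup>+z. ennreal (level z y / m y) * emeasure (W z y) A \<partial>R)"
      using y sets_kernel[OF measurable_W_fst]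
      by (intro nn_integral_cong) simp
    finally show ?thesis .
  qed
  moreover have "(\<lambda>y. \<integral>\<^sup>+z. ennreal (level z y / m y) * emeasure (W z y) A \<partial>R) \<in> borel_measurable L"
  proof -
    have "(\<lambda>w. emeasure (case w of (y, z) \<Rightarrow> W z y) A) \<in> borel_measurable (L \<Otimes>\<^sub>M R)"
      by (rule measurable_compose[OF measurable_W measurable_emeasure_subprob_algebra]) simp
    then have [measurable]: "(\<lambda>(y, z). emeasure (W z y) A) \<in> borel_measurable (L \<Otimes>\<^sub>M R)"
      by (simp add: case_prod_beta')
    show ?thesis by measurable
  qed
  ultimately show "(\<lambda>y. emeasure (mixture y) A) \<in> borel_measurable L"
    by (subst measurable_cong) auto
qed (auto intro: subprob_space_mixture sets_mixture[THEN equalityD1, THEN subsetD]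
      sets_mixture[THEN equalityD2, THEN subsetD])

lemma measurable_kernel_op_W [measurable]:
  assumes "f \<in> borel_measurable L"
  shows "(\<lambda>(y, z). kernel_op (W z) f y) \<in> borel_measurable (L \<Otimes>\<^sub>M R)"
  using measurable_compose[OF measurable_W integral_measurable_subprob_algebra[OF assms]]
  by (simp add: kernel_op_def case_prod_beta')

section \<open>The quadratic form of a mixture as an integral over the levels\<close>

context
  fixes f :: "'a \<Rightarrow> real"
  assumes f [measurable]: "f \<in> borel_measurable L" and f2: "integrable L (\<lambda>y. m y * (f y)\<^sup>2)"
begin

lemma nn_integral_kernel_square_level:
  assumes z: "z \<in> X2 X m"
  shows "(\<integral>\<^sup>+y. ennreal (level z y) * (\<integral>\<^sup>+y'. ennreal ((f y')\<^sup>2) \<partial>W z y) \<partial>L)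
    = (\<integral>\<^sup>+y. ennreal (level z y) * ennreal ((f y)\<^sup>2) \<partial>L)"
proof -
  interpret stationary_kernel "Pi1 X m z" "W z" by (rule stationary_W[OF z])
  have "(\<lambda>y. \<integral>\<^sup>+y'. ennreal ((f y')\<^sup>2) \<partial>W z y) \<in> borel_measurable (Pi1 X m z)"
    by (rule measurable_nn_integral_kernel) measurable
  then have "(\<lambda>y. \<integral>\<^sup>+y'. ennreal ((f y')\<^sup>2) \<partial>W z y) \<in> borel_measurable L"
    by (simp cong: measurable_cong_sets)
  then show ?thesis
    by (simp add: nn_integral_Pi1[OF z] nn_integral_kernel)
qed

text \<open>The integrand on the product space whose two iterated integrals are the quadratic form
  of the mixture and the integral of the forms on the slices, before normalization by
  \<open>c\<close>.\<close>

definition "F = (\<lambda>(y, z). level z y * (f y * kernel_op (W z) f y))"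

lemma measurable_F: "F \<in> borel_measurable (L \<Otimes>\<^sub>M R)"
  unfolding F_def by measurable

text \<open>The absolute integrability that Fubini needs. A product is bounded by the sum of the
  squares; the square of the kernel image is handled by Jensen and invariance and contributes no
  more than the square of \<open>f\<close>, whence the factor 2.\<close>

lemma integrable_F: "integrable (L \<Otimes>\<^sub>M R) F"
proof (rule integrableI_bounded)
  show "F \<in> borel_measurable (L \<Otimes>\<^sub>M R)" by (rule measurable_F)
  have "(\<integral>\<^sup>+y. ennreal (norm (F (y, z))) \<partial>L)
      \<le> 2 * (\<integral>\<^sup>+y. ennreal (level z y) * ennreal ((f y)\<^sup>2) \<partial>L)" if z: "z \<in> X2 X m" for z
  proof -
    interpret stationary_kernel "Pi1 X m z" "W z" by (rule stationary_W[OF z])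
    let ?I = "\<lambda>y. \<integral>\<^sup>+y'. ennreal ((f y')\<^sup>2) \<partial>W z y"
    have "?I \<in> borel_measurable (Pi1 X m z)"
      by (rule measurable_nn_integral_kernel) measurable
    then have I [measurable]: "?I \<in> borel_measurable L"
      by (simp cong: measurable_cong_sets)
    have "ennreal (norm (F (y, z)))
        \<le> ennreal (level z y) * ennreal ((f y)\<^sup>2) + ennreal (level z y) * ?I y" if y: "y \<in> X" for y
    proof -
      have "norm (F (y, z)) \<le> level z y * ((f y)\<^sup>2 + (kernel_op (W z) f y)\<^sup>2)"
        by (simp add: F_def abs_mult[of "level z y"] mult_left_mono abs_mult_le_sum_squares)
      then have "ennreal (norm (F (y, z))) \<le> ennreal (level z y) * (ennreal ((f y)\<^sup>2) + ennreal ((kernel_op (W z) f y)\<^sup>2))"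
        by (simp add: ennreal_mult[symmetric] ennreal_plus[symmetric] ennreal_leI del: ennreal_plus)
      also have "\<dots> \<le> ennreal (level z y) * (ennreal ((f y)\<^sup>2) + ?I y)"
        using y by (intro mult_left_mono add_left_mono kernel_op_square_le) auto
      finally show ?thesis by (simp add: distrib_left)
    qed
    then have "(\<integral>\<^sup>+y. ennreal (norm (F (y, z))) \<partial>L)
        \<le> (\<integral>\<^sup>+y. ennreal (level z y) * ennreal ((f y)\<^sup>2) + ennreal (level z y) * ?I y \<partial>L)"
      by (intro nn_integral_mono) simp
    also have "\<dots> = 2 * (\<integral>\<^sup>+y. ennreal (level z y) * ennreal ((f y)\<^sup>2) \<partial>L)"
      by (subst nn_integral_add) (auto simp: nn_integral_kernel_square_level[OF z] mult_2)
    finally show ?thesis .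
  qed
  then have "(\<integral>\<^sup>+z. \<integral>\<^sup>+y. ennreal (norm (F (y, z))) \<partial>L \<partial>R)
      \<le> (\<integral>\<^sup>+z. 2 * (\<integral>\<^sup>+y. ennreal (level z y) * ennreal ((f y)\<^sup>2) \<partial>L) \<partial>R)"
    by (intro nn_integral_mono) simp
  also have "\<dots> = 2 * (\<integral>\<^sup>+z. \<integral>\<^sup>+y. ennreal (level z y) * ennreal ((f y)\<^sup>2) \<partial>L \<partial>R)"
    by (rule nn_integral_cmult) measurable
  also have "\<dots> < \<infinity>"
    using nn_integral_level_square_finite[OF f f2] by (simp add: ennreal_mult_less_top)
  finally show "(\<integral>\<^sup>+w. ennreal (norm (F w)) \<partial>(L \<Otimes>\<^sub>M R)) < \<infinity>"
    using LR.nn_integral_snd[of "\<lambda>w. ennreal (norm (F w))"] measurable_F by simp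
qed

text \<open>Allows \<open>f\<close> to be integrated level by level. The second moments under
  \<open>mixture y\<close>, weighted by \<open>m y\<close>, have a finite integral, so almost all of
  them are finite; as \<open>mixture y\<close> is a finite measure, \<open>f\<close> itself is then
  integrable.\<close>

lemma AE_integrable_mixture: "AE y in L. integrable (mixture y) f"
proof -
  have "(\<lambda>w. \<integral>\<^sup>+y'. ennreal ((f y')\<^sup>2) \<partial>(case w of (y, z) \<Rightarrow> W z y)) \<in> borel_measurable (L \<Otimes>\<^sub>M R)"
    by (rule measurable_compose[OF measurable_W nn_integral_measurable_subprob_algebra]) simp
  then have I [measurable]: "(\<lambda>(y, z). \<integral>\<^sup>+y'. ennreal ((f y')\<^sup>2) \<partial>W z y) \<in> borel_measurable (L \<Otimes>\<^sub>M R)"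
    by (simp add: case_prod_beta')
  let ?H = "\<lambda>y z. ennreal (level z y) * (\<integral>\<^sup>+y'. ennreal ((f y')\<^sup>2) \<partial>W z y)"
  have H [measurable]: "(\<lambda>(y, z). ?H y z) \<in> borel_measurable (L \<Otimes>\<^sub>M R)"
    by measurable
  have "(\<integral>\<^sup>+y. \<integral>\<^sup>+z. ?H y z \<partial>R \<partial>L) = (\<integral>\<^sup>+z. \<integral>\<^sup>+y. ?H y z \<partial>L \<partial>R)"
    by (rule LR.Fubini'[OF H, symmetric])
  also have "\<dots> = (\<integral>\<^sup>+z. \<integral>\<^sup>+y. ennreal (level z y) * ennreal ((f y)\<^sup>2) \<partial>L \<partial>R)"
    by (intro nn_integral_cong nn_integral_kernel_square_level) simp
  also have "\<dots> \<noteq> \<infinity>" using nn_integral_level_square_finite[OF f f2] by simp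
  finally have "AE y in L. (\<integral>\<^sup>+z. ?H y z \<partial>R) \<noteq> \<infinity>"
    by (intro nn_integral_PInf_AE) measurable
  then show ?thesis
    using AE_space
  proof eventually_elim
    case (elim y)
    then have y: "y \<in> X" by simp
    have Hy [measurable]: "?H y \<in> borel_measurable R"
      using measurable_compose_Pair1[OF _ H, of y] y by simp
    interpret My: subprob_space "mixture y" by (rule subprob_space_mixture[OF y])
    have fy [measurable]: "f \<in> borel_measurable (mixture y)"
      using f by (simp add: sets_mixture[OF y] cong: measurable_cong_sets)
    have "(\<integral>\<^sup>+y'. ennreal ((f y')\<^sup>2) \<partial>mixture y) = (\<integral>\<^sup>+z. ennreal (1 / m y) * ?H y z \<partial>R)"
      using m_pos[OF y] by (subst nn_integral_mixture[OF y])
        (auto intro!: nn_integral_cong simp: mult.assoc[symmetric] ennreal_mult[symmetric])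
    also have "\<dots> = ennreal (1 / m y) * (\<integral>\<^sup>+z. ?H y z \<partial>R)"
      by (rule nn_integral_cmult) simp
    also have "\<dots> < \<infinity>" using elim by (simp add: ennreal_mult_less_top less_top[symmetric] ennreal_mult_eq_top_iff)
    finally have "integrable (mixture y) (\<lambda>y'. (f y')\<^sup>2)"
      by (intro integrableI_nonneg) auto
    then show ?case by (rule My.square_integrable_imp_integrable[OF fy])
  qed
qed

text \<open>The factor \<open>level z y\<close> is \<open>m y\<close> times the density of the level
  given \<open>y\<close>, so integrating over \<open>z\<close> rebuilds the mixture and leaves the
  weight \<open>m y\<close>.\<close>

lemma AE_integral_F: "AE y in L. (\<integral>z. F (y, z) \<partial>R) = m y * (f y * kernel_op mixture f y)"
  using AE_integrable_mixture AE_space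
proof eventually_elim
  case (elim y)
  then have y: "y \<in> X" by simp
  note [measurable] = measurable_W_fst[OF y] measurable_level_snd[OF y]
  have K [measurable]: "(\<lambda>z. \<integral>y'. f y' \<partial>W z y) \<in> borel_measurable R"
    by measurable
  have "kernel_op mixture f y = (\<integral>z. (\<integral>y'. f y' \<partial>W z y) \<partial>density R (\<lambda>z. ennreal (level z y / m y)))"
    unfolding kernel_op_def mixture_def restrict_Pi2[OF y]
  proof (rule integral_bind_integrable[OF _ f])
    show "integrable (density R (\<lambda>z. ennreal (level z y / m y)) \<bind> (\<lambda>z. W z y)) f"
      using elim(1) unfolding mixture_def restrict_Pi2[OF y] .
  qed (use measurable_W_fst[OF y] in auto)
  also have "\<dots> = (\<integral>z. level z y / m y * (\<integral>y'. f y' \<partial>W z y) \<partial>R)"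
    using m_pos[OF y] by (subst integral_density) (auto intro!: divide_nonneg_pos)
  finally have "kernel_op mixture f y = (\<integral>z. level z y * (\<integral>y'. f y' \<partial>W z y) \<partial>R) / m y"
    by simp
  moreover have "(\<integral>z. F (y, z) \<partial>R) = f y * (\<integral>z. level z y * (\<integral>y'. f y' \<partial>W z y) \<partial>R)"
    unfolding integral_mult_right_zero[symmetric] by (simp add: F_def kernel_op_def mult_ac)
  ultimately show ?case using m_pos[OF y] by simp
qed

lemma integral_F_level:
  assumes z: "z \<in> X2 X m"
  shows "(\<integral>y. F (y, z) \<partial>L) = measure L (G X m z) * l2_inner (Pi1 X m z) f (kernel_op (W z) f)"
proof -
  interpret stationary_kernel "Pi1 X m z" "W z" by (rule stationary_W[OF z])
  have "kernel_op (W z) f \<in> borel_measurable (Pi1 X m z)" by measurable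
  then have "kernel_op (W z) f \<in> borel_measurable L" by (simp cong: measurable_cong_sets)
  then show ?thesis unfolding F_def by (simp add: integral_Pi1[OF z] l2_inner_def)
qed

lemma integrable_mixture_levels:
  "integrable R (\<lambda>z. measure L (G X m z) * l2_inner (Pi1 X m z) f (kernel_op (W z) f))"
proof -
  have "integrable R (\<lambda>z. \<integral>y. F (y, z) \<partial>L)"
    using LR.integrable_snd[of "\<lambda>y z. F (y, z)"] integrable_F by simp
  then show ?thesis
    by (rule Bochner_Integration.integrable_cong[OF refl, THEN iffD1, rotated]) (simp add: integral_F_level)
qed

text \<open>Fubini for \<open>F\<close>: integrating over \<open>z\<close> first gives the left
  side, over \<open>y\<close> first the right side. The divisor \<open>c\<close> comes from the
  density of \<open>M1\<close>.\<close>

lemma l2_inner_mixture: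
  "l2_inner (M1 X m) f (kernel_op mixture f)
    = (\<integral>z. measure L (G X m z) * l2_inner (Pi1 X m z) f (kernel_op (W z) f) \<partial>R) / c"
proof -
  have K [measurable]: "kernel_op mixture f \<in> borel_measurable L"
    unfolding kernel_op_def[abs_def]
    by (rule measurable_compose[OF measurable_mixture integral_measurable_subprob_algebra[OF f]])
  note [measurable] = measurable_F
  have "(\<integral>z. measure L (G X m z) * l2_inner (Pi1 X m z) f (kernel_op (W z) f) \<partial>R) = (\<integral>z. (\<integral>y. F (y, z) \<partial>L) \<partial>R)"
    by (rule Bochner_Integration.integral_cong) (simp_all add: integral_F_level)
  also have "\<dots> = (\<integral>y. (\<integral>z. F (y, z) \<partial>R) \<partial>L)"
    using LR.Fubini_integral[of "\<lambda>y z. F (y, z)"] integrable_F by simp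
  also have "\<dots> = (\<integral>y. m y * (f y * kernel_op mixture f y) \<partial>L)"
    by (rule integral_cong_AE[OF _ _ AE_integral_F]) measurable
  finally show ?thesis by (simp add: l2_inner_def integral_M1)
qed

end

end

section \<open>Convexity and the comparison of the two samplers\<close>

text \<open>Convexity of the power: its graph lies above the tangent at \<open>u\<close>. The
  induction multiplies by \<open>x\<close>, and the excess over the next tangent is a nonnegative
  multiple of \<open>(x - u)\<^sup>2\<close>.\<close>

lemma power_ge_tangent:
  fixes u x :: real
  assumes "0 \<le> u" "0 \<le> x"
  shows "u ^ Suc n + real (Suc n) * u ^ n * (x - u) \<le> x ^ Suc n"
proof (induction n)
  case (Suc n)
  have "x * (u ^ Suc n + real (Suc n) * u ^ n * (x - u)) - (u ^ Suc (Suc n) + real (Suc (Suc n)) * u ^ Suc n * (x - u))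
      = u ^ n * (real (Suc n) * (x - u)\<^sup>2)"
    by (simp add: algebra_simps power2_eq_square)
  also have "0 \<le> u ^ n * (real (Suc n) * (x - u)\<^sup>2)"
    using assms by simp
  finally show ?case
    using mult_left_mono[OF Suc.IH assms(2)] by simp
qed simp

text \<open>Jensen's inequality in tangent form. The mass \<open>A\<close> is split into
  \<open>B\<close>, carrying the value 1, and \<open>A - B\<close>, carrying the value
  \<open>\<gamma>\<close>; integrating the tangent at the mean \<open>u\<close> of these values
  avoids a two-valued function on an enlarged space.\<close>

lemma power_integral_le:
  fixes A B E \<gamma> :: "'b \<Rightarrow> real"
  assumes A: "integrable M A" and B: "integrable M B" and E: "integrable M E"
    and \<gamma> [measurable]: "\<gamma> \<in> borel_measurable M" and \<gamma>01: "AE z in M. \<gamma> z \<in> {0..1}"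
    and BA: "AE z in M. 0 \<le> B z \<and> B z \<le> A z"
    and EB: "AE z in M. \<bar>E z - B z\<bar> \<le> \<gamma> z * (A z - B z)"
    and N: "0 < (\<integral>z. A z \<partial>M)" and t: "0 < t"
    and \<alpha>: "(\<integral>z. \<gamma> z ^ t * A z \<partial>M) \<le> \<alpha> * (\<integral>z. A z \<partial>M)"
  shows "((\<integral>z. E z \<partial>M) / (\<integral>z. A z \<partial>M)) ^ t \<le> (\<integral>z. B z \<partial>M) / (\<integral>z. A z \<partial>M) + \<alpha>"
proof -
  note [measurable] = borel_measurable_integrable[OF A] borel_measurable_integrable[OF B]
  obtain n where n: "t = Suc n" using t by (cases t) auto
  define I where "I = (\<integral>z. A z \<partial>M)"
  define u where "u = (\<integral>z. B z + \<gamma> z * (A z - B z) \<partial>M) / I"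
  have \<gamma>D: "integrable M (\<lambda>z. \<gamma> z ^ k * D z)" if D: "integrable M D" for k and D :: "'b \<Rightarrow> real"
  proof (rule Bochner_Integration.integrable_bound[OF D])
    show "AE z in M. norm (\<gamma> z ^ k * D z) \<le> norm (D z)"
      using \<gamma>01 by eventually_elim (simp add: abs_mult mult_left_le_one_le power_le_one)
    show "(\<lambda>z. \<gamma> z ^ k * D z) \<in> borel_measurable M"
      using borel_measurable_integrable[OF D] by measurable
  qed
  note iA = \<gamma>D[OF A] and iB = \<gamma>D[OF B]
  have iAB: "integrable M (\<lambda>z. \<gamma> z ^ k * (A z - B z))" for k
    using iA[of k] iB[of k] by (simp add: right_diff_distrib)
  have iU: "integrable M (\<lambda>z. B z + \<gamma> z * (A z - B z))"
    using B iAB[of 1] by simp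
  \<comment> \<open>The bound on \<open>E - B\<close> makes the absolute value of \<open>E\<close>
    at most the integrand in the definition of \<open>u\<close>.\<close>
  have "\<bar>\<integral>z. E z \<partial>M\<bar> \<le> (\<integral>z. \<bar>E z\<bar> \<partial>M)"
    by (rule integral_abs_bound)
  also have "\<dots> \<le> (\<integral>z. B z + \<gamma> z * (A z - B z) \<partial>M)"
    by (rule integral_mono_AE) (use E iU EB BA in \<open>auto elim!: eventually_elim2\<close>)
  finally have Eu: "\<bar>(\<integral>z. E z \<partial>M) / I\<bar> \<le> u"
    using N by (simp add: u_def I_def divide_right_mono)
  then have u0: "0 \<le> u" using abs_ge_zero order_trans by blast
  have uI: "(\<integral>z. B z + \<gamma> z * (A z - B z) \<partial>M) = u * I"
    using N by (simp add: u_def I_def)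
  let ?T = "\<lambda>x. u ^ t + real t * u ^ n * (x - u)"
  have T: "?T x \<le> x ^ t" if "0 \<le> x" for x
    using power_ge_tangent[OF u0 that, of n] by (simp add: n)
  \<comment> \<open>Since \<open>u\<close> is the mean, the slope term integrates to zero and the
    tangent to exactly \<open>u ^ t * I\<close>.\<close>
  have "u ^ t * I = (u ^ t - real t * u ^ n * u) * I + real t * u ^ n * (\<integral>z. B z + \<gamma> z * (A z - B z) \<partial>M)"
    unfolding uI by (simp add: algebra_simps)
  also have "\<dots> = (\<integral>z. (u ^ t - real t * u ^ n * u) * A z + real t * u ^ n * (B z + \<gamma> z * (A z - B z)) \<partial>M)"
    using A iU by (simp add: I_def)
  also have "\<dots> \<le> (\<integral>z. B z + \<gamma> z ^ t * A z \<partial>M)"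
  proof (rule integral_mono_AE)
    show "AE z in M. (u ^ t - real t * u ^ n * u) * A z + real t * u ^ n * (B z + \<gamma> z * (A z - B z))
        \<le> B z + \<gamma> z ^ t * A z"
      using BA \<gamma>01
    proof eventually_elim
      case (elim z)
      have "(u ^ t - real t * u ^ n * u) * A z + real t * u ^ n * (B z + \<gamma> z * (A z - B z))
          = B z * ?T 1 + (A z - B z) * ?T (\<gamma> z)"
        by (simp add: algebra_simps)
      also have "\<dots> \<le> B z * 1 ^ t + (A z - B z) * \<gamma> z ^ t"
        using elim by (intro add_mono mult_left_mono T) auto
      \<comment> \<open>The nonnegative term \<open>\<gamma> z ^ t * B z\<close> is dropped from
        what is subtracted.\<close>
      also have "\<dots> \<le> B z + \<gamma> z ^ t * A z"
        using elim by (simp add: algebra_simps)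
      finally show ?case .
    qed
  qed (use A B iU iA in auto)
  also have "\<dots> = (\<integral>z. B z \<partial>M) + (\<integral>z. \<gamma> z ^ t * A z \<partial>M)"
    using B iA by simp
  also have "\<dots> \<le> (\<integral>z. B z \<partial>M) + \<alpha> * I"
    using \<alpha> by (simp add: I_def)
  finally have "u ^ t \<le> (\<integral>z. B z \<partial>M) / I + \<alpha>"
    using N by (simp add: I_def field_simps)
  \<comment> \<open>The mean of \<open>E\<close> may be negative, so it is the bound on its absolute
    value that is raised to the power.\<close>
  moreover have "((\<integral>z. E z \<partial>M) / I) ^ t \<le> u ^ t"
    using power_mono[OF Eu abs_ge_zero, of t] abs_ge_self[of "((\<integral>z. E z \<partial>M) / I) ^ t"]
    by (simp add: power_abs)
  ultimately show ?thesis by (simp add: I_def)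
qed

section \<open>Null sets of levels, and the two samplers as mixtures\<close>

context slice_sampler
begin

text \<open>Every slice has positive volume, so a set of levels that is null for \<open>M2\<close>
  is Lebesgue null. The property is pulled back to the region \<open>D\<close> below the graph; if
  it failed at a typical level \<open>z\<close>, almost no point would lie in the slice at
  \<open>z\<close>.\<close>

lemma AE_M2_imp_AE_R:
  assumes "AE z in M2 X m. P z"
  shows "AE z in R. P z"
proof -
  define D where "D = {(y, z) \<in> X \<times> X2 X m. z < m y}"
  have D_eq: "D = {w \<in> space (L \<Otimes>\<^sub>M R). snd w < m (fst w)}"
    by (auto simp: space_pair_measure D_def)
  have D [measurable]: "D \<in> sets (L \<Otimes>\<^sub>M R)"
    unfolding D_eq by measurable
  have ind: "indicator D (y, z) = indicator (G X m z) y" if "y \<in> X" "z \<in> X2 X m" for y z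
    using that by (auto simp: indicator_def G_def D_def)
  have Dsnd: "emeasure (L \<Otimes>\<^sub>M R) D = (\<integral>\<^sup>+z. emeasure L (G X m z) \<partial>R)"
  proof -
    have "emeasure (L \<Otimes>\<^sub>M R) D = (\<integral>\<^sup>+z. \<integral>\<^sup>+y. indicator D (y, z) \<partial>L \<partial>R)"
      using LR.nn_integral_snd[of "indicator D"] by simp
    also have "\<dots> = (\<integral>\<^sup>+z. \<integral>\<^sup>+y. indicator (G X m z) y \<partial>L \<partial>R)"
      by (intro nn_integral_cong) (simp add: ind)
    finally show ?thesis by simp
  qed
  \<comment> \<open>A finite and nonzero mass of \<open>D\<close> is what identifies the null sets
    of the uniform measure on \<open>D\<close>.\<close>
  have Dfin: "emeasure (L \<Otimes>\<^sub>M R) D < \<infinity>"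
  proof -
    have "emeasure (L \<Otimes>\<^sub>M R) D = (\<integral>\<^sup>+y. \<integral>\<^sup>+z. indicator D (y, z) \<partial>R \<partial>L)"
      using R.nn_integral_fst[of "indicator D" L] by simp
    also have "\<dots> \<le> (\<integral>\<^sup>+y. ennreal (m y) \<partial>L)"
    proof (rule nn_integral_mono)
      fix y assume "y \<in> space L"
      then have y: "y \<in> X" by simp
      have "(\<integral>\<^sup>+z. indicator D (y, z) \<partial>R) = (\<integral>\<^sup>+z. ennreal (level z y) \<partial>R)"
        by (rule nn_integral_cong) (use y in \<open>simp add: level_eq indicator_def D_def\<close>)
      then show "(\<integral>\<^sup>+z. indicator D (y, z) \<partial>R) \<le> ennreal (m y)"
        using nn_integral_level_le[OF y] by simp
    qed
    also have "\<dots> = (\<integral>\<^sup>+y. ennreal (norm (m y)) \<partial>L)"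
      by (rule nn_integral_cong) (use m_pos in \<open>simp add: less_imp_le\<close>)
    also have "\<dots> < \<infinity>" using integrable_m by (simp only: integrable_iff_bounded)
    finally show ?thesis .
  qed
  have R_False: "\<not> (AE z in R. False)"
  proof
    assume "AE z in R. False"
    then have "AE z in lborel. z \<notin> X2 X m"
      by (subst (asm) AE_restrict_space_iff) auto
    then have "emeasure lborel (X2 X m) = 0"
      by (subst (asm) AE_iff_measurable[of "X2 X m"]) auto
    then show False using h_pos by (simp add: X2_eq)
  qed
  have mG: "(\<lambda>z. emeasure L (G X m z)) \<in> borel_measurable R"
  proof (subst measurable_cong)
    show "emeasure L (G X m z) = (\<integral>\<^sup>+y. ennreal (level z y) \<partial>L)" for z
      by (simp add: level_def ennreal_indicator)
  qed measurable
  have Dpos: "emeasure (L \<Otimes>\<^sub>M R) D \<noteq> 0"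
  proof
    assume "emeasure (L \<Otimes>\<^sub>M R) D = 0"
    then have "AE z in R. emeasure L (G X m z) = 0"
      unfolding Dsnd by (simp add: nn_integral_0_iff_AE mG)
    then have "AE z in R. False"
      using AE_space by eventually_elim (use emeasure_G_pos in force)
    with R_False show False by simp
  qed
  have "snd \<in> Pi_joint X m \<rightarrow>\<^sub>M restrict_space borel (X2 X m)"
  proof -
    have "snd \<in> L \<Otimes>\<^sub>M R \<rightarrow>\<^sub>M restrict_space borel (X2 X m)"
      using measurable_snd[of L R] by (simp add: measurable_cong_sets[OF refl sets_R[symmetric]])
    then show ?thesis by (simp add: Pi_joint_def cong: measurable_cong_sets)
  qed
  from AE_distrD[OF this assms[unfolded M2_def]]
  have "AE w in Pi_joint X m. P (snd w)" .
  then have "AE w in L \<Otimes>\<^sub>M R. w \<in> D \<longrightarrow> P (snd w)"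
    unfolding Pi_joint_def D_def[symmetric] by (simp only: AE_uniform_measure[OF Dpos Dfin])
  \<comment> \<open>The coordinates are swapped so that the statement can be sectioned at fixed
    \<open>z\<close>.\<close>
  then have "AE w in distr (R \<Otimes>\<^sub>M L) (L \<Otimes>\<^sub>M R) (\<lambda>(x, y). (y, x)). w \<in> D \<longrightarrow> P (snd w)"
    by (subst (asm) LR.distr_pair_swap)
  then have "AE w in R \<Otimes>\<^sub>M L. (case w of (x, y) \<Rightarrow> (y, x)) \<in> D \<longrightarrow> P (snd (case w of (x, y) \<Rightarrow> (y, x)))"
    by (rule AE_distrD[rotated]) measurable
  then have "AE w in R \<Otimes>\<^sub>M L. (snd w, fst w) \<in> D \<longrightarrow> P (fst w)"
    by (simp add: case_prod_beta')
  interpret RL: pair_sigma_finite R L ..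
  have "AE z in R. AE y in L. (y, z) \<in> D \<longrightarrow> P z"
    using RL.AE_pair[OF \<open>AE w in R \<Otimes>\<^sub>M L. (snd w, fst w) \<in> D \<longrightarrow> P (fst w)\<close>] by simp
  then show ?thesis
    using AE_space
  proof eventually_elim
    case (elim z)
    then have z: "z \<in> X2 X m" by simp
    show "P z"
    proof (rule ccontr)
      assume "\<not> P z"
      then have "AE y in L. y \<notin> G X m z"
        using elim(1) z by (auto simp: G_def D_def elim!: eventually_mono)
      then have "emeasure L (G X m z) = 0"
        by (subst (asm) AE_iff_measurable[OF G_sets]) (auto simp: G_def)
      with emeasure_G_pos[OF z] show False by simp
    qed
  qed
qed

lemma measurable_emeasure_G_Int: "(\<lambda>z. emeasure L (G X m z \<inter> A)) \<in> borel_measurable R"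
  if [measurable]: "A \<in> sets L"
proof (subst measurable_cong)
  show "emeasure L (G X m z \<inter> A) = (\<integral>\<^sup>+y. ennreal (level z y) * indicator A y \<partial>L)" for z
    by (simp add: level_def ennreal_indicator indicator_inter_arith[symmetric])
qed measurable

text \<open>On each slice the sampler draws afresh whatever the current point: a constant kernel
  whose value is its own invariant measure.\<close>

lemma slice_mixture_Pi1: "slice_mixture X m (\<lambda>z y. Pi1 X m z)"
proof -
  have "Pi1 X m \<in> R \<rightarrow>\<^sub>M subprob_algebra L"
  proof (rule measurable_subprob_algebra)
    show "subprob_space (Pi1 X m z)" if "z \<in> space R" for z
      using prob_space_Pi1 that by (simp add: prob_space_imp_subprob_space)
    fix A assume A: "A \<in> sets L"
    \<comment> \<open>Intersecting with \<open>X\<close> leaves the denominator unchanged and lets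
      one measurability lemma serve both parts of the quotient.\<close>
    have "emeasure (Pi1 X m z) A = emeasure L (G X m z \<inter> A) / emeasure L (G X m z \<inter> X)" for z
      using A sets.sets_into_space[OF G_sets[of z]]
      unfolding Pi1_def by (subst emeasure_uniform_measure) (auto simp: Int_absorb2)
    then show "(\<lambda>z. emeasure (Pi1 X m z) A) \<in> borel_measurable R"
      using measurable_emeasure_G_Int[OF A] measurable_emeasure_G_Int[OF sets.top[of L]]
      by (simp add: borel_measurable_divide_ennreal)
  qed simp
  then have 1: "(\<lambda>(y, z). Pi1 X m z) \<in> L \<Otimes>\<^sub>M R \<rightarrow>\<^sub>M subprob_algebra L"
    unfolding case_prod_beta' by (rule measurable_compose[OF measurable_snd])
  have 2: "stationary_kernel (Pi1 X m z) (\<lambda>y. Pi1 X m z)" if z: "z \<in> X2 X m" for z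
  proof -
    interpret prob_space "Pi1 X m z" by (rule prob_space_Pi1[OF z])
    have "Pi1 X m z \<in> space (prob_algebra (Pi1 X m z))"
      using prob_space_axioms by (simp add: space_prob_algebra)
    then have "markov_kernel (Pi1 X m z) (\<lambda>y. Pi1 X m z)"
      by (simp add: markov_kernel_def)
    moreover have "Pi1 X m z \<bind> (\<lambda>y. Pi1 X m z) = Pi1 X m z"
      using prob_space_axioms by (intro bind_const' prob_space_imp_subprob_space) auto
    ultimately show ?thesis
      using prob_space_axioms by (simp add: stationary_kernel_def stationary_kernel_axioms_def)
  qed
  show ?thesis
    by (intro slice_mixture.intro slice_sampler_axioms slice_mixture_axioms.intro 1 2)
qed

text \<open>Setwise measurability of \<open>Q\<close> gives measurability into
  \<open>subprob_algebra L\<close>, and reversibility gives invariance; the sigma-algebras in the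
  hypotheses are those of \<open>L\<close> and \<open>R\<close>.\<close>

lemma slice_mixture_reversible:
  assumes kernel: "\<And>z. z \<in> X2 X m \<Longrightarrow> markov_kernel (restrict_space borel X) (Q z)"
    and rev: "\<And>z. z \<in> X2 X m \<Longrightarrow> reversible (Pi1 X m z) (Q z)"
    and meas: "\<And>A. A \<in> sets (restrict_space borel X) \<Longrightarrow>
      (\<lambda>(y, z). emeasure (Q z y) A)
        \<in> borel_measurable (restrict_space borel X \<Otimes>\<^sub>M restrict_space borel (X2 X m))"
  shows "slice_mixture X m Q"
proof (intro slice_mixture.intro slice_sampler_axioms slice_mixture_axioms.intro)
  have Q: "prob_space (Q z y)" "sets (Q z y) = sets L" if "y \<in> X" "z \<in> X2 X m" for y z
  proof -
    have "Q z y \<in> space (prob_algebra (restrict_space borel X))"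
      using that(1)
      by (intro measurable_space[OF kernel[OF that(2), unfolded markov_kernel_def]])
        (simp add: space_restrict_space)
    then show "prob_space (Q z y)" "sets (Q z y) = sets L"
      by (simp_all add: space_prob_algebra sets_L)
  qed
  show "(\<lambda>(y, z). Q z y) \<in> L \<Otimes>\<^sub>M R \<rightarrow>\<^sub>M subprob_algebra L"
  proof (rule measurable_subprob_algebra)
    fix A assume "A \<in> sets L"
    then have "(\<lambda>(y, z). emeasure (Q z y) A) \<in> borel_measurable (L \<Otimes>\<^sub>M R)"
      using meas[of A] sets_pair_measure_cong[OF sets_L sets_R] by (simp add: sets_L cong: measurable_cong_sets)
    then show "(\<lambda>w. emeasure (case w of (y, z) \<Rightarrow> Q z y) A) \<in> borel_measurable (L \<Otimes>\<^sub>M R)"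
      by (simp add: case_prod_beta')
  qed (auto simp: space_pair_measure Q prob_space_imp_subprob_space)
  fix z assume z: "z \<in> X2 X m"
  have "subprob_algebra (Pi1 X m z) = subprob_algebra (restrict_space borel X)"
    by (rule subprob_algebra_cong) (simp add: sets_L)
  then have "markov_kernel (Pi1 X m z) (Q z)"
    using kernel[OF z] unfolding markov_kernel_def prob_algebra_def
    by (simp add: sets_L cong: measurable_cong_sets)
  then show "stationary_kernel (Pi1 X m z) (Q z)"
    by (intro reversible_imp_stationary prob_space_Pi1 rev z)
qed

section \<open>Integrals of the squared function weighted by the level\<close>

context
  fixes f :: "'a \<Rightarrow> real"
  assumes f [measurable]: "f \<in> borel_measurable L" and f2: "integrable L (\<lambda>y. m y * (f y)\<^sup>2)"
begin

text \<open>Used with weight 1 for the norm of \<open>f\<close> and with weight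
  \<open>\<gamma> z ^ t\<close> for the average controlled by \<open>\<alpha>\<close>.\<close>

lemma integrable_level_weighted:
  assumes [measurable]: "\<phi> \<in> borel_measurable R" and \<phi>: "\<And>z. z \<in> X2 X m \<Longrightarrow> \<phi> z \<in> {0..1}"
  shows "integrable (L \<Otimes>\<^sub>M R) (\<lambda>(y, z). \<phi> z * (level z y * (f y)\<^sup>2))"
proof (rule integrableI_bounded)
  have meas [measurable]: "(\<lambda>(y, z). \<phi> z * (level z y * (f y)\<^sup>2)) \<in> borel_measurable (L \<Otimes>\<^sub>M R)"
    by measurable
  then show "(\<lambda>(y, z). \<phi> z * (level z y * (f y)\<^sup>2)) \<in> borel_measurable (L \<Otimes>\<^sub>M R)" .
  have "(\<integral>\<^sup>+w. ennreal (norm (case w of (y, z) \<Rightarrow> \<phi> z * (level z y * (f y)\<^sup>2))) \<partial>(L \<Otimes>\<^sub>M R))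
      = (\<integral>\<^sup>+z. \<integral>\<^sup>+y. ennreal (norm (\<phi> z * (level z y * (f y)\<^sup>2))) \<partial>L \<partial>R)"
    using LR.nn_integral_snd[of "\<lambda>w. ennreal (norm (case w of (y, z) \<Rightarrow> \<phi> z * (level z y * (f y)\<^sup>2)))"]
    by simp
  also have "\<dots> \<le> (\<integral>\<^sup>+z. \<integral>\<^sup>+y. ennreal (level z y) * ennreal ((f y)\<^sup>2) \<partial>L \<partial>R)"
  proof (intro nn_integral_mono)
    fix z y assume "z \<in> space R" "y \<in> space L"
    then have "\<phi> z \<in> {0..1}" using \<phi> by simp
    then have "norm (\<phi> z * (level z y * (f y)\<^sup>2)) \<le> level z y * (f y)\<^sup>2"
      by (simp add: abs_mult mult_left_le_one_le)
    then show "ennreal (norm (\<phi> z * (level z y * (f y)\<^sup>2))) \<le> ennreal (level z y) * ennreal ((f y)\<^sup>2)"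
      by (simp add: ennreal_mult[symmetric] ennreal_leI)
  qed
  also have "\<dots> < \<infinity>" by (rule nn_integral_level_square_finite[OF f f2])
  finally show "(\<integral>\<^sup>+w. ennreal (norm (case w of (y, z) \<Rightarrow> \<phi> z * (level z y * (f y)\<^sup>2))) \<partial>(L \<Otimes>\<^sub>M R)) < \<infinity>" .
qed

lemma integral_level_weighted:
  assumes [measurable]: "\<phi> \<in> borel_measurable R" and \<phi>: "\<And>z. z \<in> X2 X m \<Longrightarrow> \<phi> z \<in> {0..1}"
  shows "integrable R (\<lambda>z. \<phi> z * (\<integral>y. level z y * (f y)\<^sup>2 \<partial>L))" (is ?A)
    and "integrable L (\<lambda>y. (f y)\<^sup>2 * (\<integral>z. level z y * \<phi> z \<partial>R))" (is ?B)
    and "(\<integral>z. \<phi> z * (\<integral>y. level z y * (f y)\<^sup>2 \<partial>L) \<partial>R)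
      = (\<integral>y. (f y)\<^sup>2 * (\<integral>z. level z y * \<phi> z \<partial>R) \<partial>L)" (is ?C)
proof -
  note I = integrable_level_weighted[OF assms]
  let ?g = "\<lambda>y z. \<phi> z * (level z y * (f y)\<^sup>2)"
  show ?A using LR.integrable_snd[OF I] by simp
  have eq: "(\<integral>z. ?g y z \<partial>R) = (f y)\<^sup>2 * (\<integral>z. level z y * \<phi> z \<partial>R)" for y
    unfolding integral_mult_right_zero[symmetric] by (simp add: mult_ac)
  show ?B using LR.integrable_fst[OF I] by (simp only: eq)
  have "(\<integral>z. \<phi> z * (\<integral>y. level z y * (f y)\<^sup>2 \<partial>L) \<partial>R) = (\<integral>z. \<integral>y. ?g y z \<partial>L \<partial>R)"
    by simp
  also have "\<dots> = (\<integral>y. \<integral>z. ?g y z \<partial>R \<partial>L)"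
    by (rule LR.Fubini_integral[OF I])
  finally show ?C by (simp only: eq)
qed

text \<open>Sections of an integrable function on the product are integrable for almost every
  level.\<close>

lemma AE_integrable_Pi1: "AE z in R. integrable (Pi1 X m z) (\<lambda>y. (f y)\<^sup>2)"
proof -
  have "integrable (R \<Otimes>\<^sub>M L) (\<lambda>(z, y). level z y * (f y)\<^sup>2)"
    using LR.integrable_product_swap[OF integrable_level_weighted[of "\<lambda>_. 1"]] by simp
  interpret RL: pair_sigma_finite R L ..
  have "AE z in R. integrable L (\<lambda>y. level z y * (f y)\<^sup>2)"
    using RL.AE_integrable_fst'[OF \<open>integrable (R \<Otimes>\<^sub>M L) _\<close>] by simp
  then show ?thesis
    using AE_space by eventually_elim (simp add: integrable_Pi1)
qed

end

text \<open>Almost everywhere \<open>m y\<close> is at most \<open>h\<close>; there the interval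
  below \<open>m y\<close> lies in \<open>X2 X m\<close>, and truncating the levels at
  \<open>h\<close> loses nothing.\<close>

lemma AE_integral_level:
  fixes \<phi> :: "real \<Rightarrow> real"
  shows "AE y in L. (\<integral>z. level z y * \<phi> z \<partial>R) = (LINT z:{0<..<m y}|lborel. \<phi> z)"
  using AE_m_le AE_space
proof eventually_elim
  case (elim y)
  then show ?case
    unfolding set_lebesgue_integral_def
    by (subst integral_restrict_space)
      (auto intro!: Bochner_Integration.integral_cong simp: level_eq X2_eq indicator_def)
qed

end

section \<open>The bound for the hybrid slice sampler\<close>

theorem proposition21:
  fixes X :: "'a::euclidean_space set" and m :: "'a \<Rightarrow> real"
    and Q :: "real \<Rightarrow> 'a \<Rightarrow> 'a measure"
    and \<gamma> :: "real \<Rightarrow> real" and t :: nat and \<alpha> :: real and f :: "'a \<Rightarrow> real"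
  assumes "open X" and "X \<noteq> {}"
    and "integrable (restrict_space lborel X) m"
    and "\<And>y. y \<in> X \<Longrightarrow> 0 < m y"
    and "ess_sup X m < \<infinity>"
    and "\<And>z. z \<in> X2 X m \<Longrightarrow> markov_kernel (restrict_space borel X) (Q z)"
    and "\<And>z. z \<in> X2 X m \<Longrightarrow> reversible (Pi1 X m z) (Q z)"
    and "\<And>A. A \<in> sets (restrict_space borel X) \<Longrightarrow>
      (\<lambda>(y, z). emeasure (Q z y) A)
        \<in> borel_measurable (restrict_space borel X \<Otimes>\<^sub>M restrict_space borel (X2 X m))"
    and "\<gamma> \<in> borel_measurable (restrict_space borel (X2 X m))"
    and "\<And>z. z \<in> X2 X m \<Longrightarrow> \<gamma> z \<in> {0..1}"
    and "AE z in M2 X m. kernel_norm (Pi1 X m z) (Q z) \<le> \<gamma> z"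
    and "0 < t"
    and "\<alpha> \<in> {0..1}"
    and "AE y in M1 X m. 1 / m y * (LINT z:{0<..<m y}|lborel. \<gamma> z ^ t) \<le> \<alpha>"
    and "even t \<or> (AE z in M2 X m. kernel_psd (Pi1 X m z) (Q z))"
    and "f \<in> L2_zero (M1 X m)" and "\<not> (AE y in M1 X m. f y = 0)"
  shows "l2_inner (M1 X m) f (kernel_op (hybrid_slice_kernel X m Q) f) ^ t
           / l2_norm (M1 X m) f ^ (2 * t)
         \<le> l2_inner (M1 X m) f (kernel_op (slice_kernel X m) f) / (l2_norm (M1 X m) f)\<^sup>2 + \<alpha>"
proof -
  interpret slice_sampler X m
    by (rule slice_sampler.intro) (use assms in auto)
  interpret S: slice_mixture X m "\<lambda>z y. Pi1 X m z" by (rule slice_mixture_Pi1)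
  interpret H: slice_mixture X m Q by (rule slice_mixture_reversible[OF assms(6-8)])
  have f [measurable]: "f \<in> borel_measurable L"
    using assms(16) by (simp add: L2_zero_def cong: measurable_cong_sets)
  have f2: "integrable L (\<lambda>y. m y * (f y)\<^sup>2)"
    using assms(16) by (simp add: L2_zero_def integrable_M1)
  have \<gamma> [measurable]: "\<gamma> \<in> borel_measurable R"
    using assms(9) by (simp cong: measurable_cong_sets)
  have \<gamma>t: "\<gamma> z ^ t \<in> {0..1}" if "z \<in> X2 X m" for z
    using assms(10)[OF that] by (simp add: power_le_one)
  define A where "A z = (\<integral>y. level z y * (f y)\<^sup>2 \<partial>L)" for z
  \<comment> \<open>Written as the form of the constant kernel, \<open>B\<close> falls under the
    same mixture formula as \<open>E\<close>.\<close>
  define B where "B z = measure L (G X m z) * l2_inner (Pi1 X m z) f (kernel_op (\<lambda>y. Pi1 X m z) f)" for z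
  define E where "E z = measure L (G X m z) * l2_inner (Pi1 X m z) f (kernel_op (Q z) f)" for z
  have iA: "integrable R A"
    using integral_level_weighted(1)[OF f f2, of "\<lambda>_. 1"] by (simp add: A_def[abs_def])
  have iB: "integrable R B" and iE: "integrable R E"
    using S.integrable_mixture_levels[OF f f2] H.integrable_mixture_levels[OF f f2]
    by (simp_all add: B_def[abs_def] E_def[abs_def])
  have inner_S: "l2_inner (M1 X m) f (kernel_op (slice_kernel X m) f) = (\<integral>z. B z \<partial>R) / c"
    using S.l2_inner_mixture[OF f f2]
    by (simp add: B_def S.mixture_def[abs_def] slice_kernel_def[abs_def])
  have inner_H: "l2_inner (M1 X m) f (kernel_op (hybrid_slice_kernel X m Q) f) = (\<integral>z. E z \<partial>R) / c"
    using H.l2_inner_mixture[OF f f2]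
    by (simp add: E_def H.mixture_def[abs_def] hybrid_slice_kernel_def[abs_def])
  \<comment> \<open>The case of weight 1: the levels below \<open>m y\<close> have total length
    \<open>m y\<close>.\<close>
  have int_A: "(\<integral>z. A z \<partial>R) = (\<integral>y. m y * (f y)\<^sup>2 \<partial>L)"
  proof -
    have "(\<integral>z. A z \<partial>R) = (\<integral>y. (f y)\<^sup>2 * (\<integral>z. level z y * 1 \<partial>R) \<partial>L)"
      using integral_level_weighted(3)[OF f f2, of "\<lambda>_. 1"] by (simp add: A_def)
    also have "\<dots> = (\<integral>y. m y * (f y)\<^sup>2 \<partial>L)"
    proof (rule integral_cong_AE)
      show "AE y in L. (f y)\<^sup>2 * (\<integral>z. level z y * 1 \<partial>R) = m y * (f y)\<^sup>2"
        using AE_integral_level[of "\<lambda>_. 1"] AE_space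
      proof eventually_elim
        case (elim y)
        then have "(LINT z:{0<..<m y}|lborel. (1::real)) = m y"
          using m_pos[of y] by (simp add: set_lebesgue_integral_def)
        with elim show ?case by (simp only: mult.commute)
      qed
    qed (use integral_level_weighted(2)[OF f f2, of "\<lambda>_. 1"] in auto)
    finally show ?thesis .
  qed
  have norm_f: "(l2_norm (M1 X m) f)\<^sup>2 = (\<integral>z. A z \<partial>R) / c"
  proof -
    have "0 \<le> l2_inner (M1 X m) f f" by (simp add: l2_inner_def)
    then have "(l2_norm (M1 X m) f)\<^sup>2 = l2_inner (M1 X m) f f" by (simp add: l2_norm_def)
    then show ?thesis by (simp add: l2_inner_def integral_M1 int_A power2_eq_square)
  qed
  have "(\<integral>z. A z \<partial>R) \<noteq> 0"
  proof
    have nonneg: "AE y in L. 0 \<le> m y * (f y)\<^sup>2"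
      by (rule AE_I2) (use m_pos in \<open>simp add: less_imp_le\<close>)
    assume "(\<integral>z. A z \<partial>R) = 0"
    then have "AE y in L. m y * (f y)\<^sup>2 = 0"
      unfolding int_A by (simp add: integral_nonneg_eq_0_iff_AE[OF f2 nonneg])
    then have "AE y in L. f y = 0"
      using AE_space by eventually_elim (use m_pos in force)
    with assms(17) show False by (simp add: AE_M1_iff)
  qed
  moreover have "0 \<le> (\<integral>z. A z \<partial>R)"
    by (simp add: A_def integral_nonneg)
  ultimately have N: "0 < (\<integral>z. A z \<partial>R)" by simp
  \<comment> \<open>Almost every level suffices: there \<open>f\<close> is square integrable on the
    slice, and the norm bound has been transferred from \<open>M2\<close>.\<close>
  have level_bounds: "AE z in R. (0 \<le> B z \<and> B z \<le> A z) \<and> \<bar>E z - B z\<bar> \<le> \<gamma> z * (A z - B z)"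
    using AE_integrable_Pi1[OF f f2] AE_M2_imp_AE_R[OF assms(11)] AE_space
  proof eventually_elim
    case (elim z)
    then have z: "z \<in> X2 X m" by simp
    interpret stationary_kernel "Pi1 X m z" "Q z" by (rule H.stationary_W[OF z])
    let ?\<mu> = "\<integral>y. f y \<partial>Pi1 X m z" and ?G = "measure L (G X m z)"
    have fz: "f \<in> borel_measurable (Pi1 X m z)" by measurable
    have A: "A z = ?G * (\<integral>y. (f y)\<^sup>2 \<partial>Pi1 X m z)"
      unfolding A_def by (rule integral_Pi1[OF z]) simp
    have B: "B z = ?G * ?\<mu>\<^sup>2"
      by (simp add: B_def l2_inner_def kernel_op_def power2_eq_square)
    \<comment> \<open>Nonnegativity of the variance permits replacing the operator norm by
      \<open>\<gamma> z\<close>.\<close>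
    have var: "0 \<le> (\<integral>y. (f y)\<^sup>2 \<partial>Pi1 X m z) - ?\<mu>\<^sup>2"
      using variance_positive[of f] variance_eq[OF integrable_of_square[OF fz elim(1)] elim(1)] by simp
    have "\<bar>E z - B z\<bar> = ?G * \<bar>l2_inner (Pi1 X m z) f (kernel_op (Q z) f) - ?\<mu>\<^sup>2\<bar>"
      unfolding E_def B right_diff_distrib[symmetric] by (simp add: abs_mult)
    also have "\<dots> \<le> ?G * (\<gamma> z * ((\<integral>y. (f y)\<^sup>2 \<partial>Pi1 X m z) - ?\<mu>\<^sup>2))"
      using l2_inner_kernel_op_bound[OF fz elim(1)] mult_right_mono[OF elim(2) var]
      by (intro mult_left_mono) auto
    also have "\<dots> = \<gamma> z * (A z - B z)" by (simp add: A B algebra_simps)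
    finally have "\<bar>E z - B z\<bar> \<le> \<gamma> z * (A z - B z)" .
    moreover have "0 \<le> B z" by (simp add: B)
    moreover have "B z \<le> A z" unfolding A B using var by (simp add: mult_left_mono)
    ultimately show ?case by blast
  qed
  \<comment> \<open>With the levels integrated first, the inner integral is that of
    \<open>\<gamma> z ^ t\<close> below \<open>m y\<close>, almost everywhere at most
    \<open>\<alpha> * m y\<close> by hypothesis.\<close>
  have "(\<integral>z. \<gamma> z ^ t * A z \<partial>R) = (\<integral>y. (f y)\<^sup>2 * (\<integral>z. level z y * \<gamma> z ^ t \<partial>R) \<partial>L)"
    unfolding A_def by (rule integral_level_weighted(3)[OF f f2]) (use \<gamma>t in auto)
  also have "\<dots> \<le> (\<integral>y. \<alpha> * (m y * (f y)\<^sup>2) \<partial>L)"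
  proof (rule integral_mono_AE)
    show "integrable L (\<lambda>y. (f y)\<^sup>2 * (\<integral>z. level z y * \<gamma> z ^ t \<partial>R))"
      by (rule integral_level_weighted(2)[OF f f2]) (use \<gamma>t in auto)
    show "AE y in L. (f y)\<^sup>2 * (\<integral>z. level z y * \<gamma> z ^ t \<partial>R) \<le> \<alpha> * (m y * (f y)\<^sup>2)"
      using AE_integral_level[of "\<lambda>z. \<gamma> z ^ t"] assms(14)[unfolded AE_M1_iff] AE_space
    proof eventually_elim
      case (elim y)
      then have "(\<integral>z. level z y * \<gamma> z ^ t \<partial>R) \<le> \<alpha> * m y"
        using m_pos[of y] by (simp add: field_simps)
      from mult_left_mono[OF this zero_le_power2[of "f y"]] show ?case
        by (simp add: mult_ac)
    qed
  qed (use f2 in simp)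
  finally have \<alpha>: "(\<integral>z. \<gamma> z ^ t * A z \<partial>R) \<le> \<alpha> * (\<integral>z. A z \<partial>R)"
    by (simp add: int_A)
  have "((\<integral>z. E z \<partial>R) / (\<integral>z. A z \<partial>R)) ^ t \<le> (\<integral>z. B z \<partial>R) / (\<integral>z. A z \<partial>R) + \<alpha>"
  proof (rule power_integral_le[OF iA iB iE \<gamma> _ _ _ N assms(12) \<alpha>])
    show "AE z in R. \<gamma> z \<in> {0..1}" by (rule AE_I2) (use assms(10) in simp)
    show "AE z in R. 0 \<le> B z \<and> B z \<le> A z" "AE z in R. \<bar>E z - B z\<bar> \<le> \<gamma> z * (A z - B z)"
      using level_bounds by (auto elim: eventually_mono)
  qed
  \<comment> \<open>The norm to the power \<open>2 * t\<close> is the \<open>t\<close>-th power of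
    its square, and the common divisor \<open>c\<close> cancels in both quotients.\<close>
  then show ?thesis
    unfolding power_mult norm_f inner_S inner_H power_divide[symmetric] using c_pos by simp
qed

end
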